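(* Let $N\ge1$, $D_1>0$, $D_2>0$ and $0<p\le q$ with $pq>1$. For initial data $(\mu,\nu)$ consider the problem $$(\mathrm{P})\quad \partial_t u=D_1\Delta u+v^p,\quad \partial_t v=D_2\Delta v+u^q,\quad u,v\ge0\ \text{ in }\mathbf{R}^N\times(0,T),\quad (u(\cdot,0),v(\cdot,0))=(\mu,\nu)\ \text{ in }\mathbf{R}^N.$$ (a) Assume $\frac{q+1}{pq-1}<\frac N2$. There is a constant $K_a>0$ depending only on $N,D_1,D_2,p,q$ such that, if $(\mu,\nu)$ is a pair of nonnegative measurable functions in $\mathbf{R}^N$ satisfying $$\mu(x)\ge c_{a,1}|x|^{-\frac{2(p+1)}{pq-1}},\qquad \nu(x)\ge c_{a,2}|x|^{-\frac{2(q+1)}{pq-1}}$$ in a neighborhood of $0$ with $c_{a,1},c_{a,2}>0$, and if $c_{a,1}\ge K_a$ or $c_{a,2}\ge K_a$, then (P) possesses no local-in-time solutions. (b) Assume $\frac{q+1}{pq-1}=\frac N2$ and $p<q$. There is a constant $K_b>0$ depending only on $N,D_1,D_2,p,q$ such that, if $(\mu,\nu)$ is a pair of nonnegative measurable functions in $\mathbf{R}^N$ satisfying $$\mu(x)\ge c_{b,1}|x|^{-\frac{2(p+1)}{pq-1}}|\log|x||^{-\frac{p}{pq-1}},\qquad \nu(x)\ge c_{b,2}|x|^{-N}|\log|x||^{-\frac1{pq-1}-1}$$ in a neighborhood of $0$ with $c_{b,1},c_{b,2}>0$, and if $c_{b,1}\ge K_b$ or $c_{b,2}\ge K_b$, then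 (P) possesses no local-in-time solutions. (c) Assume $\frac{q+1}{pq-1}=\frac N2$ and $p=q$. There is a constant $K_c>0$ depending only on $N,D_1,D_2,p,q$ such that, if $(\mu,\nu)$ is a pair of nonnegative measurable functions in $\mathbf{R}^N$ satisfying $$\mu(x)\ge c_{c,1}|x|^{-N}|\log|x||^{-\frac N2-1},\qquad \nu(x)\ge c_{c,2}|x|^{-N}|\log|x||^{-\frac N2-1}$$ in a neighborhood of $0$ with $c_{c,1},c_{c,2}>0$, and if $c_{c,1}\ge K_c$ or $c_{c,2}\ge K_c$, then (P) possesses no local-in-time solutions. (d) Assume $\frac{q+1}{pq-1}>\frac N2$ and $q>1+\frac2N$. Let $\mu$ be a nonnegative measurable function in $\mathbf{R}^N$ such that $\mu(x)\ge|x|^{-\frac{N+2}{q}}h_1(|x|)$ in a neighborhood of $0$, where $h_1$ is a positive continuous function in $(0,1]$ such that $s^{-\epsilon}h_1(s)$ is monotonically decreasing in $(0,\delta)$ for some $\epsilon>0$ and $\delta>0$. Let $\nu$ be a Radon measure in $\mathbf{R}^N$. Assume either $$\int_0^1\tau^{-1}h_1(\tau)^q\,d\tau=\infty\quad\text{or}\quad\sup_{x\in\mathbf{R}^N}\nu(B(x,1))=\infty.$$ Then (P) possesses no local-in-time solutions. (e) Assume $\frac{q+1}{pq-1}>\frac N2$ and $q=1+\frac2N$. Let $\mu$ be a nonnegative measurable function in $\mathbf{R}^N$ such that $\mu(x)\ge|x|^{-N}h_2(|x|)$ in a neighborhood of $0$, where $h_2$ is a positive continuous function in $(0,1]$. Let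 $\nu$ be a Radon measure in $\mathbf{R}^N$. Assume either $$\int_0^1\left[\int_0^r\tau^{-1}h_2(\tau)\,d\tau\right]^q r^{-1}\,dr=\infty\quad\text{or}\quad\sup_{x\in\mathbf{R}^N}\nu(B(x,1))=\infty.$$ Then (P) possesses no local-in-time solutions. (f) Assume $\frac{q+1}{pq-1}>\frac N2$ and $q<1+\frac2N$. Let $(\mu,\nu)$ be a pair of Radon measures in $\mathbf{R}^N$. Then (P) possesses no local-in-time solutions if either $$\sup_{x\in\mathbf{R}^N}\mu(B(x,1))=\infty\quad\text{or}\quad\sup_{x\in\mathbf{R}^N}\nu(B(x,1))=\infty.$$
   Context: Radon measures are nonnegative. $B(x,r)$ is the ball of center $x$ and radius $r$ in $\mathbf{R}^N$. Let $G(x,t)=(4\pi t)^{-N/2}\exp(-|x|^2/(4t))$; for a Radon measure $\mu$ set $[S(t)\mu](x)=\int_{\mathbf{R}^N}G(x-y,t)\,d\mu(y)$, and for a nonnegative measurable function $\mu$ set $[S(t)\mu](x)=\int_{\mathbf{R}^N}G(x-y,t)\mu(y)\,dy$. Let each of $\mu,\nu$ be a Radon measure or a nonnegative measurable function in $\mathbf{R}^N$. A pair $(u,v)$ of nonnegative measurable functions in $\mathbf{R}^N\times(0,T)$ is a solution to (P) in $\mathbf{R}^N\times(0,T)$ if $u(x,t)<\infty$, $v(x,t)<\infty$ and $$u(x,t)=[S(D_1t)\mu](x)+\int_0^t[S(D_1(t-s))v(s)^p](x)\,ds,$$ $$v(x,t)=[S(D_2t)\nu](x)+\int_0^t[S(D_2(t-s))u(s)^q](x)\,ds$$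 for almost all $x\in\mathbf{R}^N$ and $0<t<T$. "(P) possesses no local-in-time solutions" means that there is no $T>0$ for which (P) has a solution in $\mathbf{R}^N\times(0,T)$. *)

theory Defs
  imports "HOL-Analysis.Analysis"
begin

definition radon_measure :: "(real ^ 'n) measure \<Rightarrow> bool" where
  "radon_measure M \<longleftrightarrow>
     sets M = sets borel \<and>
     (\<forall>K. compact K \<longrightarrow> emeasure M K < \<infinity>) \<and>
     (\<forall>B \<in> sets borel. emeasure M B = (SUP K \<in> {K. compact K \<and> K \<subseteq> B}. emeasure M K))"

text \<open>Nonnegative measurable functions are Lebesgue measurable and take values in
  \<^typ>\<open>ennreal\<close>, that is, in $[0,\infty]$.\<close>

definition nonneg_measurable :: "(real ^ 'n \<Rightarrow> ennreal) \<Rightarrow> bool" where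
  "nonneg_measurable f \<longleftrightarrow> f \<in> borel_measurable lebesgue"

text \<open>The real power on $[0,\infty]$, used with \<open>a > 0\<close> only (so that $0^a = 0$ and
  $\infty^a = \infty$).\<close>

definition ennpow :: "ennreal \<Rightarrow> real \<Rightarrow> ennreal" where
  "ennpow x a = (if x = \<infinity> then \<infinity> else ennreal (enn2real x powr a))"

definition heat_kernel :: "real ^ 'n \<Rightarrow> real \<Rightarrow> real" where
  "heat_kernel x t =
     (4 * pi * t) powr (- real CARD('n) / 2) * exp (- (norm x)\<^sup>2 / (4 * t))"

definition heat_measure :: "real \<Rightarrow> (real ^ 'n) measure \<Rightarrow> real ^ 'n \<Rightarrow> ennreal" where
  "heat_measure t M x = (\<integral>\<^sup>+ y. ennreal (heat_kernel (x - y) t) \<partial>M)"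

definition heat_fun :: "real \<Rightarrow> (real ^ 'n \<Rightarrow> ennreal) \<Rightarrow> real ^ 'n \<Rightarrow> ennreal" where
  "heat_fun t f x = (\<integral>\<^sup>+ y. ennreal (heat_kernel (x - y) t) * f y \<partial>lebesgue)"

text \<open>Each initial datum is either a measure or a function, independently of the other one.\<close>

datatype 'n initial_datum =
    Measure_Datum "(real ^ 'n) measure"
  | Function_Datum "real ^ 'n \<Rightarrow> ennreal"

primrec heat_datum :: "real \<Rightarrow> 'n::finite initial_datum \<Rightarrow> real ^ 'n \<Rightarrow> ennreal" where
  "heat_datum t (Measure_Datum M) = heat_measure t M"
| "heat_datum t (Function_Datum f) = heat_fun t f"

text \<open>The integral equations are required for almost every point $(x,t)$ of
  $\mathbf{R}^N \times (0,T)$ with respect to Lebesgue measure on the product.\<close>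

definition is_solution ::
  "real \<Rightarrow> real \<Rightarrow> real \<Rightarrow> real \<Rightarrow> 'n::finite initial_datum \<Rightarrow> 'n initial_datum \<Rightarrow> real \<Rightarrow>
   (real ^ 'n \<Rightarrow> real \<Rightarrow> ennreal) \<Rightarrow> (real ^ 'n \<Rightarrow> real \<Rightarrow> ennreal) \<Rightarrow> bool" where
  "is_solution D1 D2 p q \<mu> \<nu> T u v \<longleftrightarrow>
     (\<lambda>(x, t). u x t) \<in> borel_measurable (lebesgue_on (UNIV \<times> {0<..<T})) \<and>
     (\<lambda>(x, t). v x t) \<in> borel_measurable (lebesgue_on (UNIV \<times> {0<..<T})) \<and>
     (AE (x, t) in lebesgue_on (UNIV \<times> {0<..<T}).
        u x t < \<infinity> \<and> v x t < \<infinity> \<and>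
        u x t = heat_datum (D1 * t) \<mu> x
          + (\<integral>\<^sup>+ s \<in> {0<..<t}. heat_fun (D1 * (t - s)) (\<lambda>y. ennpow (v y s) p) x \<partial>lebesgue) \<and>
        v x t = heat_datum (D2 * t) \<nu> x
          + (\<integral>\<^sup>+ s \<in> {0<..<t}. heat_fun (D2 * (t - s)) (\<lambda>y. ennpow (u y s) q) x \<partial>lebesgue))"

definition no_local_solutions ::
  "real \<Rightarrow> real \<Rightarrow> real \<Rightarrow> real \<Rightarrow> 'n::finite initial_datum \<Rightarrow> 'n initial_datum \<Rightarrow> bool" where
  "no_local_solutions D1 D2 p q \<mu> \<nu> \<longleftrightarrow> \<not> (\<exists>T>0. \<exists>u v. is_solution D1 D2 p q \<mu> \<nu> T u v)"

text \<open>\<open>f x \<ge> g x\<close> in a neighborhood of \<open>0\<close>. The neighborhood is punctured because the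
  lower bounds \<open>g\<close> in question are singular at the origin.\<close>

definition ge_near_0 :: "(real ^ 'n \<Rightarrow> ennreal) \<Rightarrow> (real ^ 'n \<Rightarrow> real) \<Rightarrow> bool" where
  "ge_near_0 f g \<longleftrightarrow> (\<forall>\<^sub>F x in at 0. ennreal (g x) \<le> f x)"

definition pos_cont :: "(real \<Rightarrow> real) \<Rightarrow> bool" where
  "pos_cont h \<longleftrightarrow> continuous_on {0<..1} h \<and> (\<forall>s \<in> {0<..1}. h s > 0)"

end

theory Submission
  imports Defs
begin

text \<open>A solution dominates the right sides of both integral equations and is finite almost
  everywhere; for the data considered these two properties are contradictory. A lower bound that depends on time only and holds on a
  family of balls is fed into one equation, yields a lower bound of the same kind for the other unknown,
  and so on, until one of the two functions is infinite on a set of positive measure. The bounds pass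
  through the powers \<open>p\<close> and \<open>q\<close> pointwise rather than by convexity, so that \<open>p < 1\<close> and
  \<open>p \<ge> 1\<close> are treated alike.

  On the parabola \<open>norm x < sqrt t\<close> the heat kernel with source in \<open>norm y < sqrt s\<close>,
  \<open>s \<le> t / 2\<close>, is at least a constant times \<open>t powr (- N / 2)\<close>. Hence \<open>u \<ge> f\<close> on the
  parabola implies \<open>v \<ge> \<kappa> * t powr (- N / 2) * (\<integral> s \<in> {0<..<t/2}. s powr (N / 2) * f s powr q)\<close>
  there (\<open>parabola_duhamel\<close>). This one estimate is used in two ways.

  \<^item> Parts (a) to (c): the threshold profiles of \<open>\<mu>\<close> and \<open>\<nu>\<close> produce multiples of weights
  \<open>t powr (- a) * \<bar>ln t\<bar> powr (- b)\<close> as lower bounds for \<open>u\<close> and \<open>v\<close>. With the exponents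
  of the theorem these weights are reproduced by going once through each equation, whereas the factor
  \<open>K\<close> becomes \<open>C * K powr (p * q)\<close>. Since \<open>p * q > 1\<close>, a large \<open>K\<close> at least doubles in every
  round (\<open>blow_up_from_large_weight\<close>). The time interval stays the same in all rounds,
  and the threshold for \<open>K\<close> is independent of it, so it may be as short as the neighborhoods of
  \<open>0\<close> in the hypotheses require. A round may start at \<open>u\<close> or at \<open>v\<close>; hence a large constant
  in one of the two profiles suffices.

  \<^item> Parts (d) and (e), divergent integral: the bound for \<open>u\<close> that comes from \<open>\<mu>\<close> turns the integral
  in the bound for \<open>v\<close> into a multiple of the given divergent one, restricted to a neighborhood of
  \<open>0\<close>, after the substitution \<open>r = sqrt s\<close>
  (\<open>blow_up_from_divergent_dini\<close>).

  The remaining alternatives in (d), (e) and (f), where unit balls carry unbounded mass, concern no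
  particular point or scale. A unit ball of very large mass forces the solution above a large constant
  \<open>M\<close> on that ball for all \<open>t\<close> between \<open>T / 4\<close> and \<open>T\<close>. On such a cylinder the
  equations dominate a system of superlinear ordinary differential equations, which blows up before
  time \<open>T / 2\<close> (\<open>blow_up_from_large_cylinder\<close>).\<close>

section \<open>Integral inequalities and lower bounds\<close>

text \<open>Fubini for null sets. Time becomes the outer variable because
  Duhamel's formula uses, for almost every \<open>s\<close>, what holds for almost every \<open>y\<close>.\<close>

lemma AE_lebesgue_strip_iterate:
  fixes P :: "'a::euclidean_space \<Rightarrow> real \<Rightarrow> bool"
  assumes "AE (x, t) in lebesgue_on (UNIV \<times> {0<..<T}). P x t"
  shows "AE t in lborel. 0 < t \<and> t < T \<longrightarrow> (AE x in lborel. P x t)"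
proof -
  have strip: "open (UNIV \<times> {0<..<T} :: ('a \<times> real) set)"
    by (intro open_Times) auto
  have "AE z in lebesgue. z \<in> UNIV \<times> {0<..<T} \<longrightarrow> (case z of (x, t) \<Rightarrow> P x t)"
    using assms strip by (subst (asm) AE_restrict_space_iff) auto
  then have "AE z in (lborel :: ('a \<times> real) measure). z \<in> UNIV \<times> {0<..<T} \<longrightarrow> (case z of (x, t) \<Rightarrow> P x t)"
    by (simp add: AE_completion_iff)
  then have "AE z in ((lborel :: 'a measure) \<Otimes>\<^sub>M (lborel :: real measure)).
      z \<in> UNIV \<times> {0<..<T} \<longrightarrow> (case z of (x, t) \<Rightarrow> P x t)"
    by (simp only: lborel_prod)
  then obtain N where N: "N \<in> sets (lborel \<Otimes>\<^sub>M lborel)" "emeasure (lborel \<Otimes>\<^sub>M lborel) N = 0"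
      "{z. \<not> (z \<in> UNIV \<times> {0<..<T} \<longrightarrow> (case z of (x, t) \<Rightarrow> P x t))} \<subseteq> N"
    by (auto elim!: AE_E simp: space_pair_measure)
  have slice: "(\<lambda>x. (x, t)) -` N \<in> sets lborel" for t
    using measurable_sets[OF measurable_Pair2' N(1), of t] by simp
  have "(\<integral>\<^sup>+t. emeasure lborel ((\<lambda>x. (x, t)) -` N) \<partial>lborel) = 0"
    using N lborel_pair.emeasure_pair_measure_alt2[of N] by simp
  then have "AE t in lborel. emeasure lborel ((\<lambda>x. (x, t)) -` N) = 0"
    using N(1) by (subst (asm) nn_integral_0_iff_AE)
      (auto intro!: lborel_pair.measurable_emeasure_Pair2)
  then show ?thesis
  proof eventually_elim
    case (elim t)
    show ?case
    proof
      assume "0 < t \<and> t < T"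
      then have "{x \<in> space lborel. \<not> P x t} \<subseteq> (\<lambda>x. (x, t)) -` N"
        using N(3) by fastforce
      then show "AE x in lborel. P x t"
        using slice[of t] elim by (intro AE_I[where N="(\<lambda>x. (x, t)) -` N"]) auto
    qed
  qed
qed

text \<open>One of the two integral equations, weakened to an inequality for the unknown
  \<open>w\<close> with the other unknown \<open>g\<close> as source. The system is two instances of it, with
  \<open>(g, w)\<close> being \<open>(v, u)\<close> and \<open>(u, v)\<close>, so that every estimate is stated once.\<close>

definition duhamel_ge ::
  "real \<Rightarrow> real \<Rightarrow> real \<Rightarrow> 'n::finite initial_datum \<Rightarrow> (real ^ 'n \<Rightarrow> real \<Rightarrow> ennreal) \<Rightarrow>
   (real ^ 'n \<Rightarrow> real \<Rightarrow> ennreal) \<Rightarrow> bool" where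
  "duhamel_ge D r T \<mu> g w \<longleftrightarrow>
     (AE t in lborel. 0 < t \<and> t < T \<longrightarrow> (AE x in lborel.
        heat_datum (D * t) \<mu> x
          + (\<integral>\<^sup>+ s \<in> {0<..<t}. heat_fun (D * (t - s)) (\<lambda>y. ennpow (g y s) r) x \<partial>lborel) \<le> w x t))"

definition finite_on :: "real \<Rightarrow> (real ^ 'n \<Rightarrow> real \<Rightarrow> ennreal) \<Rightarrow> bool" where
  "finite_on T w \<longleftrightarrow> (AE t in lborel. 0 < t \<and> t < T \<longrightarrow> (AE x in lborel. w x t < \<infinity>))"

lemma is_solutionD:
  assumes "is_solution D1 D2 p q \<mu> \<nu> T u v"
  shows "duhamel_ge D1 p T \<mu> v u" "duhamel_ge D2 q T \<nu> u v" "finite_on T u" "finite_on T v"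
proof -
  let ?I = "\<lambda>D w r x t. \<integral>\<^sup>+ s \<in> {0<..<t}. heat_fun (D * (t - s)) (\<lambda>y. ennpow (w y s) r) x \<partial>lebesgue"
  have "AE (x, t) in lebesgue_on (UNIV \<times> {0<..<T}). u x t < \<infinity> \<and> v x t < \<infinity> \<and>
      u x t = heat_datum (D1 * t) \<mu> x + ?I D1 v p x t \<and>
      v x t = heat_datum (D2 * t) \<nu> x + ?I D2 u q x t"
    using assms unfolding is_solution_def by blast
  then have *: "AE t in lborel. 0 < t \<and> t < T \<longrightarrow> (AE x in lborel. u x t < \<infinity> \<and> v x t < \<infinity> \<and>
      u x t = heat_datum (D1 * t) \<mu> x + ?I D1 v p x t \<and>
      v x t = heat_datum (D2 * t) \<nu> x + ?I D2 u q x t)"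
    by (rule AE_lebesgue_strip_iterate)
  have weaken: "AE t in lborel. 0 < t \<and> t < T \<longrightarrow> (AE x in lborel. Q x t)"
    if "\<And>x t. u x t < \<infinity> \<and> v x t < \<infinity> \<and>
      u x t = heat_datum (D1 * t) \<mu> x + ?I D1 v p x t \<and>
      v x t = heat_datum (D2 * t) \<nu> x + ?I D2 u q x t \<Longrightarrow> Q x t" for Q
    using *
  proof (rule eventually_mono, intro impI)
    fix t
    assume "0 < t \<and> t < T \<longrightarrow> (AE x in lborel. u x t < \<infinity> \<and> v x t < \<infinity> \<and>
        u x t = heat_datum (D1 * t) \<mu> x + ?I D1 v p x t \<and>
        v x t = heat_datum (D2 * t) \<nu> x + ?I D2 u q x t)" and "0 < t \<and> t < T"
    from mp[OF this] show "AE x in lborel. Q x t"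
      by (rule eventually_mono) (rule that)
  qed
  show "duhamel_ge D1 p T \<mu> v u" "duhamel_ge D2 q T \<nu> u v" "finite_on T u" "finite_on T v"
    unfolding duhamel_ge_def finite_on_def
    by (rule weaken, elim conjE, simp only: nn_integral_completion order_refl)+
qed

text \<open>The set may be empty at some times; a restriction of the time interval is
  expressed in this way.\<close>

definition ge_on ::
  "(real \<Rightarrow> (real ^ 'n) set) \<Rightarrow> (real \<Rightarrow> ennreal) \<Rightarrow> (real ^ 'n \<Rightarrow> real \<Rightarrow> ennreal) \<Rightarrow> bool" where
  "ge_on E f w \<longleftrightarrow> (AE t in lborel. AE x in lborel. x \<in> E t \<longrightarrow> f t \<le> w x t)"

lemma ge_on_mono:
  assumes "ge_on E f w" "\<And>t. E' t \<subseteq> E t" "\<And>t. E' t \<noteq> {} \<Longrightarrow> f' t \<le> f t"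
  shows "ge_on E' f' w"
  using assms(1) unfolding ge_on_def
proof eventually_elim
  case (elim t)
  then show ?case
  proof eventually_elim
    case (elim x)
    then show ?case using assms(2)[of t] assms(3)[of t]
      by (metis empty_iff order_trans subsetD)
  qed
qed

lemma ennpow_mono: "x \<le> y \<Longrightarrow> 0 < a \<Longrightarrow> ennpow x a \<le> ennpow y a"
  by (auto simp: ennpow_def top_unique enn2real_mono less_top intro!: ennreal_leI powr_mono2)

lemma ennpow_ennreal: "0 \<le> x \<Longrightarrow> ennpow (ennreal x) a = ennreal (x powr a)"
  by (simp add: ennpow_def)

lemma ennpow_cmult: "0 < c \<Longrightarrow> 0 < a \<Longrightarrow> ennpow (ennreal c * x) a = ennreal (c powr a) * ennpow x a"
  by (cases x) (auto simp: ennpow_def ennreal_mult_top  ennreal_mult[symmetric] powr_mult)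

text \<open>All contradictions below end here. The bounds form a sequence so that a countable
  union of exceptional null sets suffices.\<close>

lemma ge_on_unbounded_False:
  fixes w :: "real ^ 'n::finite \<Rightarrow> real \<Rightarrow> ennreal"
  assumes fin: "finite_on T w" and T: "0 \<le> a" "a < b" "b \<le> T"
    and E: "\<And>t. a < t \<Longrightarrow> t < b \<Longrightarrow> E t \<in> sets borel \<and> emeasure lborel (E t) \<noteq> 0"
    and ge: "\<And>n::nat. ge_on E (F n) w"
    and F: "\<And>t. a < t \<Longrightarrow> t < b \<Longrightarrow> (SUP n. F n t) = \<infinity>"
  shows False
proof -
  have "AE t in lborel. \<forall>n. AE x in lborel. x \<in> E t \<longrightarrow> F n t \<le> w x t"
    using ge by (auto simp: ge_on_def AE_all_countable)
  moreover note fin[unfolded finite_on_def]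
  ultimately have "AE t in lborel. \<not> (a < t \<and> t < b)"
  proof eventually_elim
    case (elim t)
    show ?case
    proof
      assume t: "a < t \<and> t < b"
      have *: "AE x in lborel. \<forall>n. x \<in> E t \<longrightarrow> F n t \<le> w x t"
        using elim(1) by (rule AE_all_countable[THEN iffD2])
      have "AE x in lborel. w x t < \<infinity>" using elim(2) t T by auto
      with * have "AE x in lborel. x \<notin> E t"
      proof eventually_elim
        case (elim x)
        show ?case
        proof
          assume "x \<in> E t"
          then have "(SUP n. F n t) \<le> w x t" using elim by (auto intro: SUP_least)
          then show False using F t elim by (auto simp: top_unique)
        qed
      qed
      then show False using E[of t] t by (auto simp: AE_iff_measurable[of "E t" lborel])
    qed
  qed
  then have "emeasure lborel {a<..<b} = 0"
    by (subst (asm) AE_iff_measurable[of "{a<..<b}"]) auto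
  then show False using T by simp
qed

section \<open>Heat kernel estimates\<close>

lemma heat_kernel_measurable [measurable]:
  "(\<lambda>y. heat_kernel (x - y) t) \<in> borel_measurable borel"
  unfolding heat_kernel_def by measurable

lemma heat_kernel_ge:
  fixes x :: "real ^ 'n::finite"
  assumes "0 < t" "t \<le> t'" "(norm x)\<^sup>2 \<le> 4 * t * R"
  shows "(4 * pi * t') powr (- real CARD('n) / 2) * exp (- R) \<le> heat_kernel x t"
proof -
  have "(4 * pi * t') powr (- real CARD('n) / 2) \<le> (4 * pi * t) powr (- real CARD('n) / 2)"
    using assms by (intro powr_mono2') auto
  moreover have "(norm x)\<^sup>2 / (4 * t) \<le> R"
    using assms by (simp add: field_simps)
  ultimately show ?thesis
    unfolding heat_kernel_def by (intro mult_mono) auto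
qed

text \<open>The exponent \<open>- 2 / D\<close> is the worst case of \<open>(norm (x - y))\<^sup>2 / (4 * D * (t - s))\<close>
  when \<open>norm (x - y) \<le> 2 * sqrt t\<close> and \<open>t - s \<ge> t / 2\<close>.\<close>

definition kernel_const :: "'n itself \<Rightarrow> real \<Rightarrow> real" where
  "kernel_const n D = (4 * pi * D) powr (- real CARD('n) / 2) * exp (- 2 / D)"

lemma kernel_const_pos: "0 < D \<Longrightarrow> 0 < kernel_const n D"
  by (simp add: kernel_const_def)

text \<open>The case \<open>s = 0\<close> serves the initial datum, the case \<open>s > 0\<close> the
  source term.\<close>

lemma heat_kernel_ge_parabola:
  fixes x y :: "real ^ 'n::finite"
  assumes D: "0 < D" and s: "0 \<le> s" "s \<le> t / 2" and t: "0 < t"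
    and x: "norm x < sqrt t" and y: "norm y < sqrt t"
  shows "kernel_const TYPE('n) D * t powr (- real CARD('n) / 2) \<le> heat_kernel (x - y) (D * (t - s))"
proof -
  have "norm (x - y) \<le> 2 * sqrt t"
    using norm_triangle_ineq4[of x y] x y by linarith
  then have "(norm (x - y))\<^sup>2 \<le> (2 * sqrt t)\<^sup>2"
    by (intro power_mono) auto
  also have "\<dots> = 4 * t" using t by (simp add: power_mult_distrib)
  also have "\<dots> \<le> 8 * (t - s)" using s by simp
  also have "\<dots> = 4 * (D * (t - s)) * (2 / D)" using D by simp
  finally have "(4 * pi * (D * t)) powr (- real CARD('n) / 2) * exp (- (2 / D))
      \<le> heat_kernel (x - y) (D * (t - s))"
    using assms by (intro heat_kernel_ge) auto
  moreover have "(4 * pi * (D * t)) powr (- real CARD('n) / 2)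
      = (4 * pi * D) powr (- real CARD('n) / 2) * t powr (- real CARD('n) / 2)"
    using D t by (subst powr_mult[symmetric]) (auto simp: mult_ac)
  ultimately show ?thesis
    by (simp add: kernel_const_def mult_ac)
qed

section \<open>Lower bounds through Duhamel's formula\<close>

text \<open>If \<open>g y s \<ge> f s\<close> for \<open>y \<in> E s\<close>, then the source at time \<open>s\<close> contributes at
  least \<open>f s\<close> to the power \<open>r\<close>, multiplied by the heat that flows from \<open>E s\<close> to \<open>x\<close>; \<open>m t s\<close> is a
  lower bound of this heat. The set \<open>J t\<close> selects the times \<open>s\<close> that are taken into account.\<close>

lemma ge_on_duhamel:
  fixes g w :: "real ^ 'n::finite \<Rightarrow> real \<Rightarrow> ennreal"
  assumes g: "ge_on E f g" and duh: "duhamel_ge D r T \<mu> g w" and r: "0 < r"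
    and E: "\<And>s. E s \<in> sets borel"
    and E': "\<And>t. E' t \<noteq> {} \<Longrightarrow> 0 < t \<and> t < T"
    and J: "\<And>t. E' t \<noteq> {} \<Longrightarrow> J t \<subseteq> {0<..<t}"
    and mass: "\<And>t x s. x \<in> E' t \<Longrightarrow> s \<in> J t \<Longrightarrow>
      m t s \<le> (\<integral>\<^sup>+ y. ennreal (heat_kernel (x - y) (D * (t - s))) * indicator (E s) y \<partial>lborel)"
  shows "ge_on E' (\<lambda>t. \<integral>\<^sup>+ s \<in> J t. m t s * ennpow (f s) r \<partial>lborel) w"
proof -
  (* all exceptional null sets are in y for fixed s, hence harmless for every x *)
  have mass_f: "m t s * ennpow (f s) r \<le> heat_fun (D * (t - s)) (\<lambda>y. ennpow (g y s) r) x"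
    if s: "AE y in lborel. y \<in> E s \<longrightarrow> f s \<le> g y s" and x: "x \<in> E' t" "s \<in> J t" for s t x
  proof -
    let ?G = "\<lambda>y. ennreal (heat_kernel (x - y) (D * (t - s)))"
    have "m t s * ennpow (f s) r \<le> (\<integral>\<^sup>+ y. ?G y * indicator (E s) y \<partial>lborel) * ennpow (f s) r"
      using mass[OF x] by (rule mult_right_mono) simp
    also have "\<dots> = (\<integral>\<^sup>+ y. ?G y * indicator (E s) y * ennpow (f s) r \<partial>lborel)"
      using E[of s] by (subst nn_integral_multc) auto
    also have "\<dots> \<le> (\<integral>\<^sup>+ y. ?G y * ennpow (g y s) r \<partial>lborel)"
    proof (rule nn_integral_mono_AE)
      show "AE y in lborel. ?G y * indicator (E s) y * ennpow (f s) r \<le> ?G y * ennpow (g y s) r"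
        using s by eventually_elim (auto simp: indicator_def intro!: mult_left_mono ennpow_mono r)
    qed
    finally show ?thesis by (simp add: heat_fun_def nn_integral_completion)
  qed
  have "AE t in lborel. 0 < t \<and> t < T \<longrightarrow> (AE x in lborel. heat_datum (D * t) \<mu> x
      + (\<integral>\<^sup>+ s \<in> {0<..<t}. heat_fun (D * (t - s)) (\<lambda>y. ennpow (g y s) r) x \<partial>lborel) \<le> w x t)"
    using duh by (simp add: duhamel_ge_def)
  then show ?thesis
    unfolding ge_on_def
  proof eventually_elim
    case (elim t)
    show ?case
    proof (cases "E' t = {}")
      case False
      then have "AE x in lborel. heat_datum (D * t) \<mu> x
        + (\<integral>\<^sup>+ s \<in> {0<..<t}. heat_fun (D * (t - s)) (\<lambda>y. ennpow (g y s) r) x \<partial>lborel) \<le> w x t"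
        using elim E' by blast
      then show ?thesis
      proof eventually_elim
        case (elim x)
        show ?case
        proof
          assume x: "x \<in> E' t"
          have "(\<integral>\<^sup>+ s \<in> J t. m t s * ennpow (f s) r \<partial>lborel)
            \<le> (\<integral>\<^sup>+ s \<in> {0<..<t}. heat_fun (D * (t - s)) (\<lambda>y. ennpow (g y s) r) x \<partial>lborel)"
          proof (rule nn_integral_mono_AE)
            show "AE s in lborel. m t s * ennpow (f s) r * indicator (J t) s
                \<le> heat_fun (D * (t - s)) (\<lambda>y. ennpow (g y s) r) x * indicator {0<..<t} s"
              using g[unfolded ge_on_def]
              by eventually_elim (use mass_f[OF _ x] J[OF False, THEN subsetD] in \<open>auto simp: indicator_def\<close>)
          qed
          also have "\<dots> \<le> w x t" using elim by (rule order_trans[rotated]) simp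
          finally show "(\<integral>\<^sup>+ s \<in> J t. m t s * ennpow (f s) r \<partial>lborel) \<le> w x t" .
        qed
      qed
    qed simp
  qed
qed

lemma ge_on_datum:
  fixes g w :: "real ^ 'n::finite \<Rightarrow> real \<Rightarrow> ennreal"
  assumes duh: "duhamel_ge D r T \<mu> g w"
    and E: "\<And>t x. x \<in> E t \<Longrightarrow> 0 < t \<and> t < T \<and> f t \<le> heat_datum (D * t) \<mu> x"
  shows "ge_on E f w"
  using duh[unfolded duhamel_ge_def] unfolding ge_on_def
proof eventually_elim
  case (elim t)
  show ?case
  proof (cases "E t = {}")
    case False
    then have "AE x in lborel. heat_datum (D * t) \<mu> x
      + (\<integral>\<^sup>+ s \<in> {0<..<t}. heat_fun (D * (t - s)) (\<lambda>y. ennpow (g y s) r) x \<partial>lborel) \<le> w x t"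
      using elim E by blast
    then show ?thesis
    proof eventually_elim
      case (elim x)
      show ?case
      proof
        assume "x \<in> E t"
        then have "f t \<le> heat_datum (D * t) \<mu> x" using E by blast
        also have "\<dots> \<le> heat_datum (D * t) \<mu> x
          + (\<integral>\<^sup>+ s \<in> {0<..<t}. heat_fun (D * (t - s)) (\<lambda>y. ennpow (g y s) r) x \<partial>lborel)" by simp
        also note elim
        finally show "f t \<le> w x t" .
      qed
    qed
  qed simp
qed

lemma heat_measure_ge:
  fixes x :: "real ^ 'n::finite"
  assumes "A \<in> sets M" "\<And>y. y \<in> A \<Longrightarrow> k \<le> heat_kernel (x - y) t"
  shows "ennreal k * emeasure M A \<le> heat_measure t M x"
proof -
  have "ennreal k * emeasure M A = (\<integral>\<^sup>+ y. ennreal k * indicator A y \<partial>M)"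
    using assms(1) by (simp add: nn_integral_cmult_indicator)
  also have "\<dots> \<le> heat_measure t M x"
    unfolding heat_measure_def
    by (intro nn_integral_mono) (auto simp: indicator_def assms(2) ennreal_leI)
  finally show ?thesis .
qed

lemma heat_fun_ge:
  fixes x :: "real ^ 'n::finite"
  assumes g: "g \<in> borel_measurable borel"
    and "\<And>y. g y \<noteq> 0 \<Longrightarrow> k \<le> heat_kernel (x - y) t"
    and "AE y in lborel. g y \<le> f y"
  shows "ennreal k * (\<integral>\<^sup>+ y. g y \<partial>lborel) \<le> heat_fun t f x"
proof -
  have "ennreal k * (\<integral>\<^sup>+ y. g y \<partial>lborel) = (\<integral>\<^sup>+ y. ennreal k * g y \<partial>lborel)"
    using g by (subst nn_integral_cmult) auto
  also have "\<dots> \<le> (\<integral>\<^sup>+ y. ennreal (heat_kernel (x - y) t) * f y \<partial>lborel)"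
  proof (rule nn_integral_mono_AE)
    show "AE y in lborel. ennreal k * g y \<le> ennreal (heat_kernel (x - y) t) * f y"
      using assms(3)
    proof eventually_elim
      case (elim y)
      then show ?case
        using assms(2)[of y] by (cases "g y = 0") (auto intro!: mult_mono ennreal_leI)
    qed
  qed
  finally show ?thesis by (simp add: heat_fun_def nn_integral_completion)
qed

section \<open>Cylinders\<close>

definition cylinder :: "real ^ 'n \<Rightarrow> real \<Rightarrow> real \<Rightarrow> real \<Rightarrow> (real ^ 'n) set" where
  "cylinder x0 a b t = (if a < t \<and> t < b then ball x0 1 else {})"

definition parabola :: "real \<Rightarrow> real \<Rightarrow> (real ^ 'n) set" where
  "parabola t0 t = (if 0 < t \<and> t < t0 then ball 0 (sqrt t) else {})"

lemma cylinder_borel [simp, measurable]: "cylinder x0 a b t \<in> sets borel"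
  by (simp add: cylinder_def)

lemma parabola_borel [simp, measurable]: "parabola t0 t \<in> sets borel"
  by (simp add: parabola_def)

lemma emeasure_ball_vec: "0 \<le> r \<Longrightarrow> emeasure lborel (ball (c :: real ^ 'n::finite) r)
    = ennreal (unit_ball_vol (real CARD('n)) * r ^ CARD('n))"
  using emeasure_ball[of r c] by simp

lemma emeasure_ball_vec_neq_0: "0 < r \<Longrightarrow> emeasure lborel (ball (c :: real ^ 'n::finite) r) \<noteq> 0"
  using unit_ball_vol_pos[of "real CARD('n)"]
  by (simp add: emeasure_ball_vec ennreal_eq_0_iff not_le)

text \<open>For \<open>S \<ge> 1\<close>, a lower bound up to time \<open>S\<close>, inside a unit ball, of the heat flow
  that starts from the indicator function of this ball.\<close>

definition mass_const :: "'n itself \<Rightarrow> real \<Rightarrow> real" where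
  "mass_const n S = (4 * pi * S) powr (- real CARD('n) / 2) * exp (- 1 / S) * unit_ball_vol (real CARD('n))"

lemma mass_const_pos: "0 < S \<Longrightarrow> 0 < mass_const n S"
  by (simp add: mass_const_def)

text \<open>Contracting the unit ball towards \<open>x\<close> by the factor \<open>\<rho> = sqrt (t / S)\<close> gives, by
  convexity, a ball of radius \<open>\<rho>\<close> inside the unit ball whose points are within \<open>2 * \<rho>\<close> of \<open>x\<close>.
  On it the kernel is of order \<open>t powr (- N / 2)\<close>, which balances the volume; the bound therefore does
  not degenerate when \<open>x\<close> is near the boundary or \<open>t\<close> near \<open>0\<close>.\<close>

lemma heat_mass_in_ball_ge:
  fixes x x0 :: "real ^ 'n::finite"
  assumes x: "x \<in> ball x0 1" and t: "0 < t" "t \<le> S" and S: "1 \<le> S"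
  shows "ennreal (mass_const TYPE('n) S)
    \<le> (\<integral>\<^sup>+ y. ennreal (heat_kernel (x - y) t) * indicator (ball x0 1) y \<partial>lborel)"
proof -
  define \<rho> where "\<rho> = sqrt (t / S)"
  have \<rho>: "0 < \<rho>" "\<rho> \<le> 1" "\<rho>\<^sup>2 = t / S"
    using t S by (auto simp: \<rho>_def real_sqrt_le_1_iff)
  define z where "z = x + \<rho> *\<^sub>R (x0 - x)"
  have sub: "ball z \<rho> \<subseteq> ball x0 1"
  proof
    fix y assume "y \<in> ball z \<rho>"
    then have "norm (y - z) < \<rho>" by (simp add: dist_norm norm_minus_commute)
    have eq: "y - x0 = (y - z) + (1 - \<rho>) *\<^sub>R (x - x0)"
      by (simp add: z_def algebra_simps)
    have "norm (y - x0) \<le> norm (y - z) + (1 - \<rho>) * norm (x - x0)"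
      unfolding eq using \<rho> norm_triangle_ineq[of "y - z" "(1 - \<rho>) *\<^sub>R (x - x0)"] by simp
    moreover have "(1 - \<rho>) * norm (x - x0) \<le> (1 - \<rho>) * 1"
      using \<rho> x by (intro mult_left_mono) (auto simp: dist_norm norm_minus_commute)
    ultimately show "y \<in> ball x0 1"
      using \<open>norm (y - z) < \<rho>\<close> by (simp add: dist_norm norm_minus_commute)
  qed
  define k where "k = (4 * pi * t) powr (- real CARD('n) / 2) * exp (- (1 / S))"
  have k: "0 \<le> k" by (simp add: k_def)
  have ker: "k \<le> heat_kernel (x - y) t" if y: "y \<in> ball z \<rho>" for y
  proof -
    have eq: "x - y = (z - y) + \<rho> *\<^sub>R (x - x0)"
      by (simp add: z_def algebra_simps)
    have "norm (x - y) \<le> norm (z - y) + \<rho> * norm (x - x0)"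
      unfolding eq using \<rho> norm_triangle_ineq[of "z - y" "\<rho> *\<^sub>R (x - x0)"] by simp
    moreover have "\<rho> * norm (x - x0) \<le> \<rho> * 1"
      using \<rho> x by (intro mult_left_mono) (auto simp: dist_norm norm_minus_commute)
    ultimately have "norm (x - y) \<le> 2 * \<rho>" using y by (simp add: dist_norm)
    then have "(norm (x - y))\<^sup>2 \<le> (2 * \<rho>)\<^sup>2" by (intro power_mono) auto
    then have "(norm (x - y))\<^sup>2 \<le> 4 * t * (1 / S)" using \<rho>(3) by (simp add: power_mult_distrib)
    then show ?thesis unfolding k_def using t by (intro heat_kernel_ge) auto
  qed
  have "mass_const TYPE('n) S = k * (unit_ball_vol (real CARD('n)) * \<rho> ^ CARD('n))"
  proof -
    have "\<rho> ^ CARD('n) = (t / S) powr (real CARD('n) / 2)"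
      using t S by (simp add: \<rho>_def powr_half_sqrt[symmetric] powr_realpow[symmetric] powr_powr)
    moreover have "(4 * pi * t) powr (- real CARD('n) / 2) * (t / S) powr (real CARD('n) / 2)
      = (4 * pi * S) powr (- real CARD('n) / 2)"
      using t S by (simp add: powr_mult powr_divide powr_minus field_simps)
    ultimately show ?thesis
      by (simp add: mass_const_def k_def mult_ac)
  qed
  then have "ennreal (mass_const TYPE('n) S) = ennreal k * emeasure lborel (ball z \<rho>)"
    using \<rho> k by (simp add: emeasure_ball_vec ennreal_mult'[symmetric])
  also have "\<dots> = (\<integral>\<^sup>+ y. ennreal k * indicator (ball z \<rho>) y \<partial>lborel)"
    by (simp add: nn_integral_cmult_indicator)
  also have "\<dots> \<le> (\<integral>\<^sup>+ y. ennreal (heat_kernel (x - y) t) * indicator (ball x0 1) y \<partial>lborel)"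
    using sub ker by (intro nn_integral_mono) (auto simp: indicator_def intro!: ennreal_leI)
  finally show ?thesis .
qed

text \<open>Waiting for a time \<open>d\<close> turns the bound \<open>M\<close> for the source into a bound of order
  \<open>d * M powr r\<close>. The delay may be arbitrarily short, in contrast to the estimate on parabolas, so
  infinitely many steps fit into a bounded time interval.\<close>

lemma cylinder_step:
  fixes g w :: "real ^ 'n::finite \<Rightarrow> real \<Rightarrow> ennreal"
  assumes D: "0 < D" and r: "0 < r" and S: "D * T \<le> S" "1 \<le> S" and ab: "0 \<le> a" "0 \<le> d"
    and M: "0 < M"
    and duh: "duhamel_ge D r T \<mu> g w"
    and g: "ge_on (cylinder x0 a T) (\<lambda>_. ennreal M) g"
  shows "ge_on (cylinder x0 (a + d) T) (\<lambda>_. ennreal (mass_const TYPE('n) S * d * M powr r)) w"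
proof -
  have "ge_on (cylinder x0 (a + d) T)
     (\<lambda>t. \<integral>\<^sup>+ s \<in> {a<..<t}. ennreal (mass_const TYPE('n) S) * ennpow (ennreal M) r \<partial>lborel) w"
  proof (rule ge_on_duhamel[OF g duh r])
    fix t x s assume x: "x \<in> cylinder x0 (a + d) T t" and s: "s \<in> {a<..<t}"
    then have t: "a + d < t" "t < T" and x: "x \<in> ball x0 1" by (auto simp: cylinder_def split: if_splits)
    have "D * (t - s) \<le> D * T" using D s t ab by (intro mult_left_mono) auto
    then have "D * (t - s) \<le> S" using S(1) by (rule order_trans)
    then have "ennreal (mass_const TYPE('n) S)
      \<le> (\<integral>\<^sup>+ y. ennreal (heat_kernel (x - y) (D * (t - s))) * indicator (ball x0 1) y \<partial>lborel)"
      using D s S by (intro heat_mass_in_ball_ge[OF x]) auto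
    moreover have "cylinder x0 a T s = ball x0 1" using s t by (auto simp: cylinder_def)
    ultimately show "ennreal (mass_const TYPE('n) S) \<le>
      (\<integral>\<^sup>+ y. ennreal (heat_kernel (x - y) (D * (t - s))) * indicator (cylinder x0 a T s) y \<partial>lborel)"
      by simp
  qed (use ab in \<open>auto simp: cylinder_def split: if_splits\<close>)
  then show ?thesis
  proof (rule ge_on_mono)
    fix t assume "cylinder x0 (a + d) T t \<noteq> {}"
    then have t: "a + d < t" by (auto simp: cylinder_def split: if_splits)
    have m: "0 < mass_const TYPE('n) S" using S by (intro mass_const_pos) simp
    have "ennreal (mass_const TYPE('n) S * d * M powr r)
      \<le> ennreal (mass_const TYPE('n) S) * ennreal (M powr r) * ennreal (t - a)"
      using m t ab mult_right_mono[of d "t - a" "M powr r"]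
      by (simp add: ennreal_mult'[symmetric] mult_ac)
    also have "\<dots> = (\<integral>\<^sup>+ s \<in> {a<..<t}. ennreal (mass_const TYPE('n) S) * ennpow (ennreal M) r \<partial>lborel)"
      using M t ab by (simp add: nn_integral_cmult_indicator ennpow_ennreal)
    finally show "ennreal (mass_const TYPE('n) S * d * M powr r) \<le> \<dots>" .
  qed simp
qed

section \<open>Blow-up for data of unbounded local mass\<close>

lemma SUP_ennreal_eq_infinity:
  fixes f :: "nat \<Rightarrow> real"
  assumes "filterlim f at_top sequentially"
  shows "(SUP n. ennreal (f n)) = \<infinity>"
proof -
  have "\<exists>i\<in>UNIV. of_nat n \<le> ennreal (f i)" for n
  proof -
    have "eventually (\<lambda>i. real n \<le> f i) sequentially"
      using assms by (simp add: filterlim_at_top)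
    then obtain i where "real n \<le> f i" by (auto simp: eventually_sequentially)
    then show ?thesis by (intro bexI[of _ i]) (auto simp: ennreal_of_nat_eq_real_of_nat intro!: ennreal_leI)
  qed
  then show ?thesis by (subst ennreal_SUP_eq_top) auto
qed

lemma filterlim_real_power_at_top: "1 < x \<Longrightarrow> filterlim (\<lambda>n. x ^ n) at_top sequentially" for x :: real
  using filterlim_realpow_sequentially_gt1[of x]
  by (intro filterlim_at_infinity_imp_filterlim_at_top) auto

text \<open>Step \<open>n\<close> uses up the time \<open>2 * d n\<close>, a geometric series with sum \<open>T / 4\<close>, and
  replaces the bound \<open>Q n\<close> by a multiple of \<open>d n powr (1 + r2) * Q n powr (r1 * r2)\<close>. The loss
  \<open>2 powr (- n * (1 + r2))\<close> caused by the short steps is made up for by geometric growth of \<open>Q\<close>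
  with ratio \<open>2 powr \<theta>\<close> exactly if \<open>\<theta> * (r1 * r2 - 1) = 1 + r2\<close>. The starting value \<open>M\<close> is
  the one for which the recursion then holds with equality.\<close>

lemma blow_up_from_large_cylinder:
  fixes D1 D2 r1 r2 T :: real
  assumes D: "0 < D1" "0 < D2" and r: "0 < r1" "0 < r2" "1 < r1 * r2" and T: "0 < T"
  shows "\<exists>M>0. \<forall>(\<mu> :: 'n::finite initial_datum) \<nu> g w x0.
    duhamel_ge D1 r1 T \<mu> g w \<longrightarrow> duhamel_ge D2 r2 T \<nu> w g \<longrightarrow> finite_on T g \<longrightarrow>
    \<not> ge_on (cylinder x0 (T / 4) T) (\<lambda>_. ennreal M) g"
proof -
  define S where "S = max 1 (max (D1 * T) (D2 * T))"
  have S: "1 \<le> S" "D1 * T \<le> S" "D2 * T \<le> S" by (auto simp: S_def)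
  define m where "m = mass_const TYPE('n) S"
  have m: "0 < m" using S unfolding m_def by (intro mass_const_pos) simp
  define \<theta> where "\<theta> = (1 + r2) / (r1 * r2 - 1)"
  define C where "C = (m * T / 16) powr (1 + r2)"
  have C: "0 < C" using m T by (simp add: C_def)
  define M where "M = (2 powr \<theta> / C) powr (1 / (r1 * r2 - 1))"
  have M: "0 < M" using C by (simp add: M_def)
  have M_fixpoint: "C * M powr (r1 * r2) = M * 2 powr \<theta>"
  proof -
    have "M powr (r1 * r2 - 1) = 2 powr \<theta> / C"
      using r C by (simp add: M_def powr_powr)
    moreover have "M powr (r1 * r2) = M powr (r1 * r2 - 1) * M"
      using M by (simp add: powr_diff)
    ultimately show ?thesis using C by simp
  qed
  define a where "a n = T / 2 - T / 4 / 2 ^ n" for n :: nat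
  define d where "d n = T / 16 / 2 ^ n" for n :: nat
  have a: "0 \<le> a n" "a n \<le> T / 2" for n
  proof -
    have "T / 4 / 2 ^ n \<le> T / 4 / 1" using T by (intro divide_left_mono) auto
    then show "0 \<le> a n" "a n \<le> T / 2" using T by (auto simp: a_def)
  qed
  have d: "0 < d n" for n using T by (simp add: d_def)
  have a_Suc: "a (Suc n) = a n + d n + d n" for n by (simp add: a_def d_def field_simps)
  define Q where "Q n = M * 2 powr (\<theta> * real n)" for n :: nat
  have Q: "0 < Q n" for n using M by (simp add: Q_def)
  have Q_Suc: "m * d n * (m * d n * Q n powr r1) powr r2 = Q (Suc n)" for n
  proof -
    have "m * d n * (m * d n * Q n powr r1) powr r2 = (m * d n) powr (1 + r2) * Q n powr (r1 * r2)"
      using m d[of n] Q[of n] by (simp add: powr_mult powr_add powr_powr mult_ac)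
    also have "(m * d n) powr (1 + r2) = ((m * T / 16) * 2 powr (- real n)) powr (1 + r2)"
      by (simp add: d_def powr_minus powr_realpow field_simps)
    also have "\<dots> = C * 2 powr (- (1 + r2) * real n)"
      using m T by (subst powr_mult) (auto simp: C_def powr_powr algebra_simps)
    also have "Q n powr (r1 * r2) = M powr (r1 * r2) * 2 powr (\<theta> * real n * (r1 * r2))"
      using M by (simp add: Q_def powr_mult powr_powr)
    also have "C * 2 powr (- (1 + r2) * real n) * (M powr (r1 * r2) * 2 powr (\<theta> * real n * (r1 * r2)))
        = (M * 2 powr \<theta>) * 2 powr (\<theta> * real n * (r1 * r2) - (1 + r2) * real n)"
      by (subst M_fixpoint[symmetric]) (simp add: powr_diff powr_minus powr_add field_simps)
    also have "\<theta> * real n * (r1 * r2) - (1 + r2) * real n = \<theta> * real n"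
    proof -
      have "\<theta> * (r1 * r2 - 1) = 1 + r2" using r by (simp add: \<theta>_def)
      then have "(\<theta> * (r1 * r2 - 1)) * real n = (1 + r2) * real n" by simp
      then show ?thesis by (simp add: algebra_simps)
    qed
    also have "(M * 2 powr \<theta>) * 2 powr (\<theta> * real n) = Q (Suc n)"
      by (simp add: Q_def powr_add algebra_simps)
    finally show ?thesis .
  qed
  show ?thesis
  proof (intro exI[of _ M] conjI M allI impI notI)
    fix \<mu> \<nu> :: "'n initial_datum" and g w x0
    assume duh: "duhamel_ge D1 r1 T \<mu> g w" "duhamel_ge D2 r2 T \<nu> w g" and fin: "finite_on T g"
      and start: "ge_on (cylinder x0 (T / 4) T) (\<lambda>_. ennreal M) g"
    have "ge_on (cylinder x0 (a n) T) (\<lambda>_. ennreal (Q n)) g" for n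
    proof (induction n)
      case 0
      then show ?case using start by (simp add: a_def Q_def)
    next
      case (Suc n)
      have "ge_on (cylinder x0 (a n + d n) T) (\<lambda>_. ennreal (m * d n * Q n powr r1)) w"
        unfolding m_def using D r S a[of n] d[of n] Q[of n] duh(1) Suc
        by (intro cylinder_step[where D=D1 and g=g]) auto
      then have "ge_on (cylinder x0 (a n + d n + d n) T)
          (\<lambda>_. ennreal (mass_const TYPE('n) S * d n * (m * d n * Q n powr r1) powr r2)) g"
        using D r S a[of n] d[of n] Q[of n] duh(2) m
        by (intro cylinder_step[where D=D2 and g=w]) auto
      then show ?case using Q_Suc[of n] by (simp add: a_Suc m_def)
    qed
    then have bound: "ge_on (cylinder x0 (T / 2) T) (\<lambda>_. ennreal (Q n)) g" for n
      by (rule ge_on_mono) (use a(2)[of n] T in \<open>auto simp: cylinder_def\<close>)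
    show False
    proof (rule ge_on_unbounded_False[OF fin _ _ _ _ bound, where a="T/2" and b=T])
      fix t assume t: "T / 2 < t" "t < T"
      have "0 < \<theta>" using r by (simp add: \<theta>_def)
      have "filterlim (\<lambda>n. M * (2 powr \<theta>) ^ n) at_top sequentially"
        using M \<open>0 < \<theta>\<close> by (intro filterlim_tendsto_pos_mult_at_top[OF tendsto_const]
          filterlim_real_power_at_top) auto
      then have "filterlim Q at_top sequentially"
        by (simp add: Q_def[abs_def] powr_powr[symmetric] powr_realpow)
      then show "(SUP n. ennreal (Q n)) = \<infinity>" by (rule SUP_ennreal_eq_infinity)
      show "cylinder x0 (T / 2) T t \<in> sets borel \<and> emeasure lborel (cylinder x0 (T / 2) T t) \<noteq> 0"
        using t by (auto simp: cylinder_def emeasure_ball_vec_neq_0)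
    qed (use T in auto)
  qed
qed

text \<open>For \<open>T / 4 < t < T\<close> and points of a unit ball, at distance at most \<open>2\<close>, the
  exponent of the kernel is at least \<open>- 4 / (D * T)\<close>.\<close>

lemma cylinder_datum:
  fixes \<mu> :: "(real ^ 'n::finite) measure"
  assumes "0 < D" "0 < T" "sets \<mu> = sets borel" "duhamel_ge D r T (Measure_Datum \<mu>) g w"
  shows "ge_on (cylinder x0 (T / 4) T)
    (\<lambda>_. ennreal ((4 * pi * (D * T)) powr (- real CARD('n) / 2) * exp (- (4 / (D * T)))) * emeasure \<mu> (ball x0 1)) w"
proof (rule ge_on_datum[OF assms(4)])
  fix t and x :: "real ^ 'n" assume "x \<in> cylinder x0 (T / 4) T t"
  then have t: "T / 4 < t" "t < T" and x: "x \<in> ball x0 1" by (auto simp: cylinder_def split: if_splits)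
  have ker: "(4 * pi * (D * T)) powr (- real CARD('n) / 2) * exp (- (4 / (D * T))) \<le> heat_kernel (x - y) (D * t)"
    if y: "y \<in> ball x0 1" for y
  proof (rule heat_kernel_ge)
    have "norm (x - y) \<le> 2" using x y dist_triangle_le[of x x0 y 2]
      by (auto simp: dist_norm norm_minus_commute)
    then have "(norm (x - y))\<^sup>2 \<le> 2\<^sup>2" by (intro power_mono) auto
    also have "\<dots> \<le> 4 * (D * t) * (4 / (D * T))" using assms t by (simp add: field_simps)
    finally show "(norm (x - y))\<^sup>2 \<le> 4 * (D * t) * (4 / (D * T))" .
  qed (use assms t in auto)
  show "0 < t \<and> t < T \<and> ennreal ((4 * pi * (D * T)) powr (- real CARD('n) / 2) * exp (- (4 / (D * T)))) * emeasure \<mu> (ball x0 1)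
    \<le> heat_datum (D * t) (Measure_Datum \<mu>) x"
    using heat_measure_ge[of "ball x0 1" \<mu>, OF _ ker] assms t by auto
qed

proposition no_solution_if_not_uniformly_local:
  fixes \<mu> :: "(real ^ 'n::finite) measure"
  assumes D: "0 < D1" "0 < D2" and r: "0 < r1" "0 < r2" "1 < r1 * r2" and T: "0 < T"
    and \<mu>: "radon_measure \<mu>" "(SUP x. emeasure \<mu> (ball x 1)) = \<infinity>"
    and duh: "duhamel_ge D1 r1 T (Measure_Datum \<mu>) w g" "duhamel_ge D2 r2 T \<nu> g w" "finite_on T g"
  shows False
proof -
  obtain M where M: "M > 0" "\<And>(\<mu> :: 'n initial_datum) \<nu> g w x0.
      duhamel_ge D2 r2 T \<mu> g w \<Longrightarrow> duhamel_ge D1 r1 T \<nu> w g \<Longrightarrow> finite_on T g \<Longrightarrow>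
      \<not> ge_on (cylinder x0 (T / 4) T) (\<lambda>_. ennreal M) g"
    using blow_up_from_large_cylinder[of D2 D1 r2 r1 T, where 'n='n] assms by (auto simp: mult.commute)
  let ?c = "(4 * pi * (D1 * T)) powr (- real CARD('n) / 2) * exp (- (4 / (D1 * T)))"
  have c: "0 < ?c" using D T by simp
  have "ennreal (M / ?c) < (SUP x. emeasure \<mu> (ball x 1))" unfolding \<mu>(2) by simp
  then obtain x0 where x0: "ennreal (M / ?c) < emeasure \<mu> (ball x0 1)" by (auto simp: less_SUP_iff)
  have "ennreal M = ennreal ?c * ennreal (M / ?c)"
    using c M by (subst ennreal_mult'[symmetric]) auto
  also have "\<dots> \<le> ennreal ?c * emeasure \<mu> (ball x0 1)"
    using x0 by (intro mult_left_mono) auto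
  finally have "ge_on (cylinder x0 (T / 4) T) (\<lambda>_. ennreal M) g"
    using cylinder_datum[OF D(1) T _ duh(1), of x0] \<mu>(1)
    by (auto simp: radon_measure_def elim!: ge_on_mono)
  then show False using M(2) duh by blast
qed

section \<open>Substitution for functions with a power law\<close>

text \<open>The sets \<open>{..<r}\<close> generate the Borel sets, so the image of \<open>M\<close> under \<open>\<phi>\<close> is
  determined by its distribution function \<open>C * r ^ m\<close>. Integration in polar coordinates is the case
  \<open>\<phi> = norm\<close>; the substitution \<open>r = sqrt s\<close> is the case \<open>C = 1\<close>, \<open>m = 2\<close>.\<close>

lemma nn_integral_power_law:
  fixes \<phi> :: "'a \<Rightarrow> real" and g :: "real \<Rightarrow> ennreal"
  assumes \<phi> [measurable]: "\<phi> \<in> borel_measurable M" and g [measurable]: "g \<in> borel_measurable borel"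
    and nonneg: "\<And>x. x \<in> space M \<Longrightarrow> 0 \<le> \<phi> x" and m: "0 < m" and C: "0 \<le> C"
    and law: "\<And>r. 0 < r \<Longrightarrow> emeasure M {x \<in> space M. \<phi> x < r} = ennreal (C * r ^ m)"
  shows "(\<integral>\<^sup>+ x. g (\<phi> x) \<partial>M) = (\<integral>\<^sup>+ r \<in> {0<..}. ennreal (C * real m * r ^ (m - 1)) * g r \<partial>lborel)"
proof -
  define f where "f r = ennreal (C * real m * r ^ (m - 1)) * indicator {0<..} r" for r :: real
  have f [measurable]: "f \<in> borel_measurable borel" unfolding f_def by measurable
  have "distr M borel \<phi> = density lborel f"
  proof (rule measure_eqI_generator_eq[where E = "range lessThan" and \<Omega> = UNIV and A = "\<lambda>n::nat. {..<real n}"])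
    show "Int_stable (range lessThan :: real set set)"
    proof -
      have "{..<a} \<inter> {..<b} = {..<min a b}" for a b :: real by auto
      then show ?thesis by (auto simp: Int_stable_def)
    qed
    show "sets (distr M borel \<phi>) = sigma_sets UNIV (range lessThan)"
      "sets (density lborel f) = sigma_sets UNIV (range lessThan)"
      by (simp_all add: borel_Iio)
    have distr: "emeasure (distr M borel \<phi>) {..<r} = (if 0 < r then ennreal (C * r ^ m) else 0)" for r
    proof -
      have "\<phi> -` {..<r} \<inter> space M = {x \<in> space M. \<phi> x < r}" by auto
      moreover have "emeasure M {x \<in> space M. \<phi> x < r} = 0" if "\<not> 0 < r"
      proof -
        have "{x \<in> space M. \<phi> x < r} = {}" using nonneg that by force
        then show ?thesis by (simp only: emeasure_empty)
      qed
      ultimately show ?thesis by (simp add: emeasure_distr law)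
    qed
    have dens: "emeasure (density lborel f) {..<r} = (if 0 < r then ennreal (C * r ^ m) else 0)" for r
    proof (cases "0 < r")
      case True
      have "emeasure (density lborel f) {..<r} = (\<integral>\<^sup>+ x. f x * indicator {..<r} x \<partial>lborel)"
        by (subst emeasure_density) auto
      also have "\<dots> = (\<integral>\<^sup>+ x. ennreal (C * real m * x ^ (m - 1)) * indicator {0..r} x \<partial>lborel)"
        using AE_lborel_singleton[of 0] AE_lborel_singleton[of r]
        by (intro nn_integral_cong_AE, eventually_elim) (auto simp: f_def indicator_def)
      also have "\<dots> = ennreal (C * r ^ m - C * 0 ^ m)"
        using True C by (intro nn_integral_FTC_Icc) (auto intro!: derivative_eq_intros)
      finally show ?thesis using True m by (simp add: zero_power)
    next
      case False
      then have "f x * indicator {..<r} x = 0" for x by (auto simp: f_def indicator_def)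
      then have "emeasure (density lborel f) {..<r} = 0"
        by (simp add: emeasure_density del: mult_eq_0_iff)
      then show ?thesis using False by simp
    qed
    show "emeasure (distr M borel \<phi>) X = emeasure (density lborel f) X" if "X \<in> range lessThan" for X
      using that distr dens by auto
    show "emeasure (distr M borel \<phi>) {..<real n} \<noteq> \<infinity>" for n by (simp add: distr)
    show "(\<Union>n::nat. {..<real n}) = UNIV" by (auto simp: reals_Archimedean2)
  qed auto
  then have "(\<integral>\<^sup>+ r. g r \<partial>distr M borel \<phi>) = (\<integral>\<^sup>+ r. g r \<partial>density lborel f)" by simp
  then show ?thesis
    by (simp add: nn_integral_distr nn_integral_density f_def[abs_def] mult_ac)
qed

lemma nn_integral_radial:
  fixes g :: "real \<Rightarrow> ennreal"
  assumes "g \<in> borel_measurable borel"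
  shows "(\<integral>\<^sup>+ x. g (norm (x :: real ^ 'n::finite)) \<partial>lborel)
    = (\<integral>\<^sup>+ r \<in> {0<..}. ennreal (unit_ball_vol (real CARD('n)) * real CARD('n) * r ^ (CARD('n) - 1)) * g r \<partial>lborel)"
proof (rule nn_integral_power_law[OF _ assms])
  fix r :: real assume "0 < r"
  moreover have "{x \<in> space lborel. norm (x :: real ^ 'n) < r} = ball 0 r" by (auto simp: dist_norm)
  ultimately show "emeasure lborel {x \<in> space lborel. norm (x :: real ^ 'n) < r}
      = ennreal (unit_ball_vol (real CARD('n)) * r ^ CARD('n))"
    by (simp add: emeasure_ball_vec)
qed auto

lemma nn_integral_sqrt_substitution:
  fixes g :: "real \<Rightarrow> ennreal"
  assumes "g \<in> borel_measurable borel"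
  shows "(\<integral>\<^sup>+ s \<in> {0<..}. g (sqrt s) \<partial>lborel) = (\<integral>\<^sup>+ r \<in> {0<..}. ennreal (2 * r) * g r \<partial>lborel)"
proof -
  let ?M = "restrict_space lborel {0::real<..}"
  have "(\<integral>\<^sup>+ s. g (sqrt s) \<partial>?M) = (\<integral>\<^sup>+ r \<in> {0<..}. ennreal (1 * real 2 * r ^ (2 - 1)) * g r \<partial>lborel)"
  proof (rule nn_integral_power_law[OF _ assms])
    fix r :: real assume r: "0 < r"
    have "{s \<in> space ?M. sqrt s < r} = {0<..<r\<^sup>2}"
      using r real_less_lsqrt real_sqrt_less_iff[of _ "r\<^sup>2"]
      by (auto simp: space_restrict_space)
    then show "emeasure ?M {s \<in> space ?M. sqrt s < r} = ennreal (1 * r\<^sup>2)"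
      by (simp add: emeasure_restrict_space subset_iff)
  qed (auto simp: space_restrict_space intro!: measurable_restrict_space1)
  then show ?thesis by (simp add: nn_integral_restrict_space)
qed

lemma nn_integral_inverse_interval:
  assumes "0 < a" "a \<le> b"
  shows "(\<integral>\<^sup>+ s \<in> {a<..<b}. ennreal (1 / s) \<partial>lborel) = ennreal (ln (b / a))"
proof -
  have "(\<integral>\<^sup>+ s \<in> {a<..<b}. ennreal (1 / s) \<partial>lborel) = (\<integral>\<^sup>+ s. ennreal (1 / s) * indicator {a..b} s \<partial>lborel)"
    using AE_lborel_singleton[of a] AE_lborel_singleton[of b]
    by (intro nn_integral_cong_AE, eventually_elim) (auto simp: indicator_def)
  also have "\<dots> = ennreal (ln b - ln a)"
    using assms by (intro nn_integral_FTC_Icc) (auto intro!: derivative_eq_intros)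
  also have "ln b - ln a = ln (b / a)" using assms by (simp add: ln_div)
  finally show ?thesis .
qed

section \<open>Parabolas\<close>

text \<open>The kernel bound \<open>t powr (- N / 2)\<close> times the volume \<open>s powr (N / 2)\<close> of the slice at
  time \<open>s\<close>. The bound obtained for \<open>w\<close> holds on the same parabola as the one
  assumed for \<open>g\<close>, so the step can be iterated although it looks back by the factor \<open>2\<close> in time.\<close>

lemma parabola_duhamel:
  fixes g w :: "real ^ 'n::finite \<Rightarrow> real \<Rightarrow> ennreal"
  assumes D: "0 < D" and r: "0 < r" and t0: "t0 \<le> T"
    and duh: "duhamel_ge D r T \<mu> g w"
    and g: "ge_on (parabola t0) f g"
    and J: "\<And>t. 0 < t \<Longrightarrow> t < t0 \<Longrightarrow> J t \<subseteq> {0<..t / 2}"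
  shows "ge_on (parabola t0) (\<lambda>t. \<integral>\<^sup>+ s \<in> J t.
    ennreal (kernel_const TYPE('n) D * unit_ball_vol (real CARD('n)) * t powr (- real CARD('n) / 2) * s powr (real CARD('n) / 2))
      * ennpow (f s) r \<partial>lborel) w"
proof (rule ge_on_duhamel[OF g duh r])
  fix t s and x :: "real ^ 'n" assume x: "x \<in> parabola t0 t" and s: "s \<in> J t"
  then have t: "0 < t" "t < t0" and x: "norm x < sqrt t" by (auto simp: parabola_def split: if_splits)
  have s: "0 < s" "s \<le> t / 2" using subsetD[OF J[OF t] s] by auto
  let ?k = "kernel_const TYPE('n) D * t powr (- real CARD('n) / 2)"
  have k: "0 \<le> ?k" using kernel_const_pos[OF D, of "TYPE('n)"] by simp
  have P: "parabola t0 s = ball 0 (sqrt s)" using s t by (simp add: parabola_def)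
  have "sqrt s ^ CARD('n) = s powr (real CARD('n) / 2)"
    using s by (simp add: powr_half_sqrt[symmetric] powr_realpow[symmetric] powr_powr)
  then have "ennreal (kernel_const TYPE('n) D * unit_ball_vol (real CARD('n)) * t powr (- real CARD('n) / 2) * s powr (real CARD('n) / 2))
    = ennreal ?k * emeasure lborel (ball (0 :: real ^ 'n) (sqrt s))"
    using k s by (simp add: emeasure_ball_vec ennreal_mult'[symmetric] mult_ac)
  also have "\<dots> = (\<integral>\<^sup>+ y. ennreal ?k * indicator (ball (0 :: real ^ 'n) (sqrt s)) y \<partial>lborel)"
    by (simp add: nn_integral_cmult_indicator)
  also have "\<dots> \<le> (\<integral>\<^sup>+ y. ennreal (heat_kernel (x - y) (D * (t - s))) * indicator (parabola t0 s) y \<partial>lborel)"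
  proof (intro nn_integral_mono)
    fix y :: "real ^ 'n"
    have "ennreal ?k \<le> ennreal (heat_kernel (x - y) (D * (t - s)))" if "norm y < sqrt s"
    proof (intro ennreal_leI heat_kernel_ge_parabola[OF D _ s(2) t(1) x])
      show "norm y < sqrt t" using that s by (auto elim!: less_le_trans)
    qed (use s in auto)
    then show "ennreal ?k * indicator (ball 0 (sqrt s)) y
      \<le> ennreal (heat_kernel (x - y) (D * (t - s))) * indicator (parabola t0 s) y"
      by (auto simp: P indicator_def)
  qed
  finally show "ennreal (kernel_const TYPE('n) D * unit_ball_vol (real CARD('n)) * t powr (- real CARD('n) / 2) * s powr (real CARD('n) / 2))
    \<le> (\<integral>\<^sup>+ y. ennreal (heat_kernel (x - y) (D * (t - s))) * indicator (parabola t0 s) y \<partial>lborel)" .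
next
  fix t assume "parabola t0 t \<noteq> ({} :: (real ^ 'n) set)"
  then show "0 < t \<and> t < T" "J t \<subseteq> {0<..<t}" using J[of t] t0 by (fastforce simp: parabola_def split: if_splits)+
qed simp

text \<open>The same estimate for a datum with a radial lower bound \<open>h\<close> near the origin,
  integrated over the shell of radii \<open>J t\<close> in polar coordinates.\<close>

lemma parabola_datum:
  fixes f :: "real ^ 'n::finite \<Rightarrow> ennreal"
  assumes D: "0 < D" and t0: "t0 \<le> T" "t0 \<le> d\<^sup>2" "0 < d"
    and duh: "duhamel_ge D r T (Function_Datum f) g w"
    and f: "\<And>x. x \<noteq> 0 \<Longrightarrow> norm x < d \<Longrightarrow> h (norm x) \<le> f x"
    and h: "(\<lambda>s. h s * indicator {0<..<d} s) \<in> borel_measurable borel"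
    and J: "\<And>t. J t \<in> sets borel" "\<And>t. J t \<subseteq> {0<..<sqrt t}"
  shows "ge_on (parabola t0) (\<lambda>t. ennreal (kernel_const TYPE('n) D * t powr (- real CARD('n) / 2))
    * (\<integral>\<^sup>+ r \<in> J t. ennreal (unit_ball_vol (real CARD('n)) * real CARD('n) * r ^ (CARD('n) - 1)) * h r \<partial>lborel)) w"
proof (rule ge_on_datum[OF duh])
  fix t and x :: "real ^ 'n" assume "x \<in> parabola t0 t"
  then have t: "0 < t" "t < t0" and x: "norm x < sqrt t" by (auto simp: parabola_def split: if_splits)
  have d: "sqrt t < d" using t t0 by (intro real_less_lsqrt) auto
  define H where "H s = h s * indicator (J t) s" for s
  have H: "H \<in> borel_measurable borel"
  proof -
    have "H = (\<lambda>s. (h s * indicator {0<..<d} s) * indicator (J t) s)"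
      using J(2)[of t] d by (fastforce simp: H_def indicator_def)
    also have "\<dots> \<in> borel_measurable borel"
      using J(1) by (intro borel_measurable_times_ennreal h borel_measurable_indicator) auto
    finally show ?thesis .
  qed
  have "ennreal (kernel_const TYPE('n) D * t powr (- real CARD('n) / 2)) * (\<integral>\<^sup>+ y. H (norm (y :: real ^ 'n)) \<partial>lborel)
      \<le> heat_fun (D * t) f x"
  proof (rule heat_fun_ge)
    show "(\<lambda>y :: real ^ 'n. H (norm y)) \<in> borel_measurable borel" using H by measurable
    show "kernel_const TYPE('n) D * t powr (- real CARD('n) / 2) \<le> heat_kernel (x - y) (D * t)"
      if "H (norm y) \<noteq> 0" for y
    proof -
      have "norm y < sqrt t" using that J(2)[of t] by (auto simp: H_def indicator_def split: if_splits)
      then show ?thesis using heat_kernel_ge_parabola[OF D, of 0 t x y] t x by simp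
    qed
    show "AE y in lborel. H (norm y) \<le> f y"
      using J(2)[of t] f d by (intro AE_I2) (fastforce simp: H_def indicator_def)
  qed
  also have "(\<integral>\<^sup>+ y. H (norm (y :: real ^ 'n)) \<partial>lborel)
    = (\<integral>\<^sup>+ r \<in> J t. ennreal (unit_ball_vol (real CARD('n)) * real CARD('n) * r ^ (CARD('n) - 1)) * h r \<partial>lborel)"
    unfolding nn_integral_radial[OF H]
    using J(2)[of t] by (intro nn_integral_cong) (fastforce simp: H_def indicator_def)
  finally show "0 < t \<and> t < T \<and> ennreal (kernel_const TYPE('n) D * t powr (- real CARD('n) / 2))
    * (\<integral>\<^sup>+ r \<in> J t. ennreal (unit_ball_vol (real CARD('n)) * real CARD('n) * r ^ (CARD('n) - 1)) * h r \<partial>lborel)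
    \<le> heat_datum (D * t) (Function_Datum f) x" using t t0 by simp
qed

section \<open>Weights reproduced by the system\<close>

definition weight :: "real \<Rightarrow> real \<Rightarrow> real \<Rightarrow> real" where
  "weight a b t = t powr (- a) * \<bar>ln t\<bar> powr (- b)"

text \<open>The effect of one integral equation with power \<open>r\<close> on the exponents. The first
  case records the contribution of the times \<open>s\<close> comparable with \<open>t\<close>. In the second case the integrand
  is \<open>1 / s\<close> up to logarithms, all scales between \<open>t\<^sup>2\<close> and \<open>t\<close> contribute equally, and one power
  of the logarithm is gained.\<close>

definition weight_transfer :: "real \<Rightarrow> real \<Rightarrow> real \<Rightarrow> real \<Rightarrow> real \<Rightarrow> real \<Rightarrow> bool" where
  "weight_transfer N r a b a' b' \<longleftrightarrow>
     (a' = a * r - 1 \<and> b' = b * r) \<or> (a * r = N / 2 + 1 \<and> a' = N / 2 \<and> b' = b * r - 1)"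

lemma weight_pos: "0 < t \<Longrightarrow> t < 1 \<Longrightarrow> 0 < weight a b t"
  by (simp add: weight_def)

lemma powr_ge_within_factor_4:
  fixes s t e :: real
  assumes "0 < t" "t / 4 \<le> s" "s \<le> t"
  shows "4 powr (- \<bar>e\<bar>) * t powr e \<le> s powr e"
proof (cases "0 \<le> e")
  case True
  have "4 powr (- \<bar>e\<bar>) * t powr e = (t / 4) powr e"
    using assms True by (simp add: powr_divide powr_minus field_simps)
  also have "\<dots> \<le> s powr e" using assms True by (intro powr_mono2) auto
  finally show ?thesis .
next
  case False
  have "4 powr (- \<bar>e\<bar>) * t powr e \<le> 1 * t powr e"
    by (intro mult_right_mono) (auto simp: powr_minus inverse_le_1_iff ge_one_powr_ge_zero)
  also have "\<dots> \<le> s powr e" using assms False by (simp add: powr_mono2')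
  finally show ?thesis .
qed

lemma abs_ln_powr_ge_within_square:
  fixes s t \<beta> :: real
  assumes t: "0 < t" "t < 1" and s: "t\<^sup>2 \<le> s" "s \<le> t" and \<beta>: "0 \<le> \<beta>"
  shows "2 powr (- \<beta>) * \<bar>ln t\<bar> powr (- \<beta>) \<le> \<bar>ln s\<bar> powr (- \<beta>)"
proof -
  have s0: "0 < s" using t s by (meson less_le_trans zero_less_power)
  have "ln (t\<^sup>2) \<le> ln s" using t s s0 by (subst ln_le_cancel_iff) auto
  then have "\<bar>ln s\<bar> \<le> 2 * \<bar>ln t\<bar>" using t s s0 by (simp add: ln_realpow)
  then have "(2 * \<bar>ln t\<bar>) powr (- \<beta>) \<le> \<bar>ln s\<bar> powr (- \<beta>)"
    using t s s0 \<beta> by (intro powr_mono2') auto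
  then show ?thesis by (simp add: powr_mult)
qed

text \<open>All integrals below are compared with \<open>1 / s\<close>: over a dyadic interval this gives
  \<open>ln 2\<close>, over an interval such as \<open>(t\<^sup>2, t / 2)\<close> a multiple of \<open>\<bar>ln t\<bar>\<close>.\<close>

lemma nn_integral_ge_ln:
  assumes ab: "0 < a" "a \<le> b" and A: "0 \<le> A"
    and f: "\<And>s. a < s \<Longrightarrow> s < b \<Longrightarrow> ennreal (A / s) \<le> f s"
  shows "ennreal (A * ln (b / a)) \<le> (\<integral>\<^sup>+ s \<in> {a<..<b}. f s \<partial>lborel)"
proof -
  have "ennreal (A * ln (b / a)) = ennreal A * (\<integral>\<^sup>+ s \<in> {a<..<b}. ennreal (1 / s) \<partial>lborel)"
    using ab A by (simp add: nn_integral_inverse_interval ennreal_mult')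
  also have "\<dots> = (\<integral>\<^sup>+ s. ennreal A * (ennreal (1 / s) * indicator {a<..<b} s) \<partial>lborel)"
    by (subst nn_integral_cmult) auto
  also have "\<dots> \<le> (\<integral>\<^sup>+ s \<in> {a<..<b}. f s \<partial>lborel)"
  proof (intro nn_integral_mono)
    fix s
    have "ennreal A * ennreal (1 / s) = ennreal (A / s)"
      using A by (simp add: ennreal_mult'[symmetric])
    then show "ennreal A * (ennreal (1 / s) * indicator {a<..<b} s) \<le> f s * indicator {a<..<b} s"
      using f[of s] by (auto simp: indicator_def)
  qed
  finally show ?thesis .
qed

text \<open>In the first case of \<open>weight_transfer\<close> the times \<open>s\<close> between \<open>t / 4\<close> and
  \<open>t / 2\<close> suffice, in the second case those between \<open>t\<^sup>2\<close> and \<open>t / 2\<close>, where \<open>\<bar>ln s\<bar>\<close> still is at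
  most \<open>2 * \<bar>ln t\<bar>\<close>. The restriction \<open>t0 \<le> 1 / 4\<close> yields \<open>t\<^sup>2 \<le> t / 4\<close> and
  \<open>ln 2 \<le> \<bar>ln t\<bar> / 2\<close>. It matters for the iteration that \<open>C\<close> is independent of \<open>t0\<close> and \<open>K\<close>.\<close>

lemma weight_step:
  fixes D r a b a' b' :: real
  assumes D: "0 < D" and r: "0 < r" and b: "0 \<le> b"
    and tr: "weight_transfer (real CARD('n::finite)) r a b a' b'"
  shows "\<exists>C>0. \<forall>T t0 K (\<mu> :: 'n initial_datum) g w. 0 < K \<longrightarrow> t0 \<le> T \<longrightarrow> t0 \<le> 1 / 4 \<longrightarrow>
    duhamel_ge D r T \<mu> g w \<longrightarrow> ge_on (parabola t0) (\<lambda>t. ennreal (K * weight a b t)) g \<longrightarrow>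
    ge_on (parabola t0) (\<lambda>t. ennreal (C * K powr r * weight a' b' t)) w"
proof -
  define N where "N = real CARD('n)"
  define \<kappa> where "\<kappa> = kernel_const TYPE('n) D * unit_ball_vol N"
  have \<kappa>: "0 < \<kappa>"
    unfolding \<kappa>_def by (intro mult_pos_pos kernel_const_pos D unit_ball_vol_pos) (simp add: N_def)
  have integrand: "ennreal (\<kappa> * t powr (- N / 2) * s powr (N / 2)) * ennpow (ennreal (K * weight a b s)) r
      = ennreal (\<kappa> * t powr (- N / 2) * K powr r * s powr (N / 2 - a * r + 1) * \<bar>ln s\<bar> powr (- (b * r)) / s)"
    if "0 < s" "0 < K" for s t K
  proof -
    have "(K * weight a b s) powr r = K powr r * s powr (- (a * r)) * \<bar>ln s\<bar> powr (- (b * r))"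
      using that by (simp add: weight_def powr_mult powr_powr)
    moreover have "s powr (N / 2 - a * r + 1) = s powr (N / 2) * s powr (- (a * r)) * s"
      using that powr_add[of s "N / 2 - a * r" 1] powr_add[of s "N / 2" "- (a * r)"] by simp
    ultimately show ?thesis
      using that \<kappa> by (simp add: ennpow_ennreal ennreal_mult'[symmetric] weight_def)
  qed
  note step = parabola_duhamel[where 'n = 'n, OF D r, folded N_def, folded \<kappa>_def]
  consider (power) "a' = a * r - 1" "b' = b * r"
    | (log) "a * r = N / 2 + 1" "a' = N / 2" "b' = b * r - 1"
    using tr by (auto simp: weight_transfer_def N_def)
  then show ?thesis
  proof cases
    case power
    define e where "e = N / 2 - a * r + 1"
    define c where "c = 4 powr (- \<bar>e\<bar>) * 2 powr (- (b * r))"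
    show ?thesis
    proof (intro exI[of _ "\<kappa> * c * ln 2"] conjI allI impI)
      show "0 < \<kappa> * c * ln 2" using \<kappa> by (simp add: c_def)
      fix T t0 K and \<mu> :: "'n initial_datum" and g w
      assume K: "0 < K" and t0: "t0 \<le> T" "t0 \<le> 1 / 4" and duh: "duhamel_ge D r T \<mu> g w"
        and g: "ge_on (parabola t0) (\<lambda>t. ennreal (K * weight a b t)) g"
      show "ge_on (parabola t0) (\<lambda>t. ennreal (\<kappa> * c * ln 2 * K powr r * weight a' b' t)) w"
      proof (rule ge_on_mono[OF step[OF t0(1) duh g, where J = "\<lambda>t. {t / 4<..<t / 2}"]])
        fix t assume "parabola t0 t \<noteq> ({} :: (real ^ 'n) set)"
        then have t: "0 < t" "t \<le> 1 / 4" using t0 by (auto simp: parabola_def split: if_splits)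
        have "t\<^sup>2 \<le> t / 4" using t by (simp add: power2_eq_square)
        let ?A = "\<kappa> * t powr (- N / 2) * K powr r * (c * t powr e * \<bar>ln t\<bar> powr (- (b * r)))"
        have "ennreal (?A * ln (t / 2 / (t / 4)))
          \<le> (\<integral>\<^sup>+ s \<in> {t / 4<..<t / 2}. ennreal (\<kappa> * t powr (- N / 2) * s powr (N / 2))
            * ennpow (ennreal (K * weight a b s)) r \<partial>lborel)"
        proof (rule nn_integral_ge_ln)
          fix s assume s: "t / 4 < s" "s < t / 2"
          have "(4 powr (- \<bar>e\<bar>) * t powr e) * (2 powr (- (b * r)) * \<bar>ln t\<bar> powr (- (b * r)))
            \<le> s powr e * \<bar>ln s\<bar> powr (- (b * r))"
            using t s b r \<open>t\<^sup>2 \<le> t / 4\<close>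
            by (intro mult_mono powr_ge_within_factor_4 abs_ln_powr_ge_within_square) auto
          then have "?A / s \<le> \<kappa> * t powr (- N / 2) * K powr r * (s powr e * \<bar>ln s\<bar> powr (- (b * r))) / s"
            using \<kappa> K t s by (intro divide_right_mono mult_left_mono) (auto simp: c_def mult_ac)
          then show "ennreal (?A / s) \<le> ennreal (\<kappa> * t powr (- N / 2) * s powr (N / 2))
            * ennpow (ennreal (K * weight a b s)) r"
            using t s K by (subst integrand) (auto simp: e_def mult_ac intro!: ennreal_leI)
        qed (use t \<kappa> K in \<open>auto simp: c_def\<close>)
        also have "?A * ln (t / 2 / (t / 4)) = \<kappa> * c * ln 2 * K powr r * weight a' b' t"
        proof -
          have "t powr (- N / 2) * t powr e = t powr (- a')"
            unfolding powr_add[symmetric] by (rule arg_cong[where f = "(powr) t"]) (simp add: e_def power)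
          moreover have "t / 2 / (t / 4) = 2" using t by simp
          ultimately show ?thesis by (simp add: weight_def power)
        qed
        finally show "ennreal (\<kappa> * c * ln 2 * K powr r * weight a' b' t)
          \<le> (\<integral>\<^sup>+ s \<in> {t / 4<..<t / 2}. ennreal (\<kappa> * t powr (- N / 2) * s powr (N / 2))
            * ennpow (ennreal (K * weight a b s)) r \<partial>lborel)" .
      qed auto
    qed
  next
    case log
    define c where "c = 2 powr (- (b * r))"
    show ?thesis
    proof (intro exI[of _ "\<kappa> * c / 2"] conjI allI impI)
      show "0 < \<kappa> * c / 2" using \<kappa> by (simp add: c_def)
      fix T t0 K and \<mu> :: "'n initial_datum" and g w
      assume K: "0 < K" and t0: "t0 \<le> T" "t0 \<le> 1 / 4" and duh: "duhamel_ge D r T \<mu> g w"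
        and g: "ge_on (parabola t0) (\<lambda>t. ennreal (K * weight a b t)) g"
      show "ge_on (parabola t0) (\<lambda>t. ennreal (\<kappa> * c / 2 * K powr r * weight a' b' t)) w"
      proof (rule ge_on_mono[OF step[OF t0(1) duh g, where J = "\<lambda>t. {t\<^sup>2<..<t / 2}"]])
        fix t assume "parabola t0 t \<noteq> ({} :: (real ^ 'n) set)"
        then have t: "0 < t" "t \<le> 1 / 4" using t0 by (auto simp: parabola_def split: if_splits)
        have tt: "t\<^sup>2 \<le> t / 2" using t by (simp add: power2_eq_square)
        let ?A = "\<kappa> * t powr (- N / 2) * K powr r * (c * \<bar>ln t\<bar> powr (- (b * r)))"
        have lnt: "\<bar>ln t\<bar> / 2 \<le> ln (t / 2 / t\<^sup>2)"
        proof -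
          have "ln t \<le> ln ((1 / 2)\<^sup>2)" using t by (subst ln_le_cancel_iff) (auto simp: power2_eq_square)
          then have "ln t \<le> - 2 * ln 2" by (simp add: ln_realpow ln_div)
          moreover have "ln (t / 2 / t\<^sup>2) = - ln 2 - ln t"
            using t by (simp add: ln_div ln_mult ln_realpow)
          ultimately show ?thesis using t by simp
        qed
        have "\<kappa> * c / 2 * K powr r * weight a' b' t = ?A * (\<bar>ln t\<bar> / 2)"
          using t by (simp add: weight_def log powr_diff powr_minus field_simps)
        also have "\<dots> \<le> ?A * ln (t / 2 / t\<^sup>2)"
          using lnt \<kappa> by (intro mult_left_mono) (auto simp: c_def)
        finally have "ennreal (\<kappa> * c / 2 * K powr r * weight a' b' t) \<le> ennreal (?A * ln (t / 2 / t\<^sup>2))"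
          by (rule ennreal_leI)
        also have "\<dots> \<le> (\<integral>\<^sup>+ s \<in> {t\<^sup>2<..<t / 2}. ennreal (\<kappa> * t powr (- N / 2) * s powr (N / 2))
            * ennpow (ennreal (K * weight a b s)) r \<partial>lborel)"
        proof (rule nn_integral_ge_ln)
          fix s assume s: "t\<^sup>2 < s" "s < t / 2"
          have s0: "0 < s" using s by (meson le_less_trans zero_le_power2)
          have "2 powr (- (b * r)) * \<bar>ln t\<bar> powr (- (b * r)) \<le> \<bar>ln s\<bar> powr (- (b * r))"
            using t s b r by (intro abs_ln_powr_ge_within_square) auto
          then have "?A / s \<le> \<kappa> * t powr (- N / 2) * K powr r * (s powr (N / 2 - a * r + 1) * \<bar>ln s\<bar> powr (- (b * r))) / s"
            using \<kappa> K t s s0 by (intro divide_right_mono mult_left_mono) (auto simp: c_def mult_ac log)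
          then show "ennreal (?A / s) \<le> ennreal (\<kappa> * t powr (- N / 2) * s powr (N / 2))
            * ennpow (ennreal (K * weight a b s)) r"
            using s0 K by (subst integrand) (auto simp: mult_ac intro!: ennreal_leI)
        qed (use t tt \<kappa> K in \<open>auto simp: c_def\<close>)
        finally show "ennreal (\<kappa> * c / 2 * K powr r * weight a' b' t)
          \<le> (\<integral>\<^sup>+ s \<in> {t\<^sup>2<..<t / 2}. ennreal (\<kappa> * t powr (- N / 2) * s powr (N / 2))
            * ennpow (ennreal (K * weight a b s)) r \<partial>lborel)" .
      next
        fix t :: real
        show "{t\<^sup>2<..<t / 2} \<subseteq> {0<..t / 2}"
          by (auto intro: le_less_trans[OF zero_le_power2])
      qed auto
    qed
  qed
qed

lemma annulus_integral_ge:
  fixes h :: "real \<Rightarrow> real"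
  assumes t: "0 < t" and n: "0 < n" and A: "0 \<le> A" and m: "0 \<le> m"
    and h: "\<And>r. sqrt t / 2 < r \<Longrightarrow> r < sqrt t \<Longrightarrow> m \<le> h r"
  shows "ennreal (A * 2 powr (- real n) * ln 2 * t powr (real n / 2) * m)
    \<le> (\<integral>\<^sup>+ r \<in> {sqrt t / 2<..<sqrt t}. ennreal (A * r ^ (n - 1)) * ennreal (h r) \<partial>lborel)"
proof -
  have st: "0 < sqrt t" using t by simp
  let ?B = "A * (2 powr (- real n) * t powr (real n / 2)) * m"
  have "ennreal (?B * ln (sqrt t / (sqrt t / 2)))
    \<le> (\<integral>\<^sup>+ r \<in> {sqrt t / 2<..<sqrt t}. ennreal (A * r ^ (n - 1)) * ennreal (h r) \<partial>lborel)"
  proof (rule nn_integral_ge_ln)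
    fix s assume s: "sqrt t / 2 < s" "s < sqrt t"
    have s0: "0 < s" using s st by linarith
    have "2 powr (- real n) * t powr (real n / 2) = (sqrt t / 2) powr real n"
      using t by (simp add: powr_divide powr_minus powr_half_sqrt[symmetric] powr_powr field_simps)
    also have "\<dots> \<le> s powr real n" using s st by (intro powr_mono2) auto
    also have "\<dots> = s ^ (n - 1) * s"
      using s0 n by (simp only: powr_realpow power_minus_mult)
    finally have "A * (2 powr (- real n) * t powr (real n / 2)) \<le> A * (s ^ (n - 1) * s)"
      using A by (rule mult_left_mono)
    then have "?B \<le> A * (s ^ (n - 1) * s) * h s"
      by (rule mult_mono[OF _ h[OF s]]) (use A m s0 in auto)
    then have "?B / s \<le> A * s ^ (n - 1) * h s" using s0 by (simp add: field_simps)
    then show "ennreal (?B / s) \<le> ennreal (A * s ^ (n - 1)) * ennreal (h s)"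
      using A s0 by (simp add: ennreal_mult'[symmetric] ennreal_leI)
  qed (use st A m in auto)
  also have "sqrt t / (sqrt t / 2) = 2" using st by simp
  finally show ?thesis by (simp add: mult_ac)
qed

text \<open>The two cases correspond to those of \<open>weight_transfer\<close>. If \<open>2 * a = N\<close>, every
  dyadic shell between the radii \<open>t\<close> and \<open>sqrt t\<close> carries comparable mass; their number
  accounts for the difference of one in the exponents of the logarithm. Otherwise the single shell of
  radii between \<open>sqrt t / 2\<close> and \<open>sqrt t\<close> is enough. The constant \<open>C\<close> does not depend on the
  neighborhood in which the profile is given.\<close>

lemma weight_datum:
  fixes D a b \<beta> :: real
  assumes D: "0 < D" and a: "0 \<le> a" and b: "0 \<le> b"
    and \<beta>: "\<beta> = b \<or> (a = real CARD('n::finite) / 2 \<and> \<beta> = b + 1)"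
  shows "\<exists>C>0. \<forall>T t0 c d r (f :: real ^ 'n \<Rightarrow> ennreal) g w. 0 < c \<longrightarrow> t0 \<le> T \<longrightarrow> t0 \<le> 1 / 4 \<longrightarrow>
    0 < d \<longrightarrow> t0 \<le> d\<^sup>2 \<longrightarrow>
    (\<forall>x. x \<noteq> 0 \<longrightarrow> norm x < d \<longrightarrow> ennreal (c * norm x powr (- (2 * a)) * \<bar>ln (norm x)\<bar> powr (- \<beta>)) \<le> f x) \<longrightarrow>
    duhamel_ge D r T (Function_Datum f) g w \<longrightarrow>
    ge_on (parabola t0) (\<lambda>t. ennreal (C * c * weight a b t)) w"
proof -
  define N where "N = real CARD('n)"
  define k where "k = kernel_const TYPE('n) D"
  have k: "0 < k" using kernel_const_pos[OF D] by (simp add: k_def)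
  have N: "0 < N" by (simp add: N_def)
  define \<omega> where "\<omega> = unit_ball_vol N * N"
  have \<omega>: "0 < \<omega>" using N by (simp add: \<omega>_def)
  have integrand: "ennreal (\<omega> * s ^ (CARD('n) - 1)) * ennreal (c * s powr (- (2 * a)) * \<bar>ln s\<bar> powr (- \<beta>))
      = ennreal (\<omega> * c * s powr (N - 2 * a) * \<bar>ln s\<bar> powr (- \<beta>) / s)"
    if "0 < s" "0 < c" for s c
  proof -
    have "s ^ (CARD('n) - 1) * s = s powr N"
      using that power_minus_mult[of "CARD('n)" s] by (simp add: N_def powr_realpow)
    then have "s ^ (CARD('n) - 1) = s powr N / s" using that by (simp add: field_simps)
    moreover have "s powr (N - 2 * a) = s powr N * s powr (- (2 * a))"
      by (simp flip: powr_add)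
    ultimately show ?thesis
      using that \<omega> by (simp add: ennreal_mult'[symmetric] mult_ac)
  qed
  have ln_mono: "\<bar>ln t\<bar> powr (- \<beta>) \<le> \<bar>ln s\<bar> powr (- \<beta>)" if "0 < t" "t \<le> s" "s < 1" for s t
    using that b \<beta> by (intro powr_mono2') auto
  note datum = parabola_datum[where 'n = 'n, OF D, folded k_def N_def, folded \<omega>_def]
  from \<beta> consider (power) "\<beta> = b" | (log) "a = N / 2" "\<beta> = b + 1" by (auto simp: N_def)
  then obtain L A where LA: "0 < A"
    "\<And>t. 0 < t \<Longrightarrow> t < 1 / 4 \<Longrightarrow> 0 < L t \<and> L t < sqrt t"
    "\<And>t c. 0 < t \<Longrightarrow> t < 1 / 4 \<Longrightarrow> 0 < c \<Longrightarrow>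
      ennreal (A * c * t powr (N / 2) * weight a b t) \<le> (\<integral>\<^sup>+ r \<in> {L t<..<sqrt t}.
        ennreal (\<omega> * r ^ (CARD('n) - 1)) * ennreal (c * r powr (- (2 * a)) * \<bar>ln r\<bar> powr (- \<beta>)) \<partial>lborel)"
  proof cases
    case power
    show thesis
    proof (rule that[of "\<omega> * 2 powr (- N) * ln 2" "\<lambda>t. sqrt t / 2"])
      fix t c :: real assume t: "0 < t" "t < 1 / 4" and c: "0 < c"
      have "sqrt t < sqrt ((1 / 2)\<^sup>2)" using t by (subst real_sqrt_less_iff) (simp add: power2_eq_square)
      then have st: "0 < sqrt t" "sqrt t < 1 / 2" "t = sqrt t * sqrt t"
        using t by auto
      have tst: "t \<le> sqrt t / 2" using st by (metis mult_left_mono less_imp_le mult.right_neutral times_divide_eq_right)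
      have "ennreal (\<omega> * 2 powr (- N) * ln 2 * t powr (N / 2) * (c * t powr (- a) * \<bar>ln t\<bar> powr (- \<beta>))) \<le> (\<integral>\<^sup>+ r \<in> {sqrt t / 2<..<sqrt t}.
        ennreal (\<omega> * r ^ (CARD('n) - 1)) * ennreal (c * r powr (- (2 * a)) * \<bar>ln r\<bar> powr (- \<beta>)) \<partial>lborel)"
        unfolding N_def
      proof (rule annulus_integral_ge)
        fix s assume s: "sqrt t / 2 < s" "s < sqrt t"
        have s0: "0 < s" using s st by linarith
        have "t powr (- a) = sqrt t powr (- (2 * a))"
          using t by (simp add: powr_half_sqrt[symmetric] powr_powr)
        also have "\<dots> \<le> s powr (- (2 * a))" using s s0 a by (intro powr_mono2') auto
        finally have "t powr (- a) \<le> s powr (- (2 * a))" .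
        moreover have "\<bar>ln t\<bar> powr (- \<beta>) \<le> \<bar>ln s\<bar> powr (- \<beta>)"
          using s st tst t by (intro ln_mono) auto
        ultimately show "c * t powr (- a) * \<bar>ln t\<bar> powr (- \<beta>) \<le> c * s powr (- (2 * a)) * \<bar>ln s\<bar> powr (- \<beta>)"
          using c by (intro mult_mono) auto
      qed (use t \<omega> c in auto)
      then show "ennreal (\<omega> * 2 powr (- N) * ln 2 * c * t powr (N / 2) * weight a b t) \<le> (\<integral>\<^sup>+ r \<in> {sqrt t / 2<..<sqrt t}.
        ennreal (\<omega> * r ^ (CARD('n) - 1)) * ennreal (c * r powr (- (2 * a)) * \<bar>ln r\<bar> powr (- \<beta>)) \<partial>lborel)"
        by (simp add: weight_def power mult_ac)
    qed (use \<omega> in auto)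
  next
    case log
    show thesis
    proof (rule that[of "\<omega> / 2" "\<lambda>t. t"])
      fix t :: real assume t: "0 < t" "t < 1 / 4"
      have "t\<^sup>2 < t" using t by (simp add: power2_eq_square)
      then have tst: "t < sqrt t" using real_less_rsqrt by blast
      then show "0 < t \<and> t < sqrt t" using t by simp
      fix c :: real assume c: "0 < c"
      let ?A = "\<omega> * c * \<bar>ln t\<bar> powr (- \<beta>)"
      have "ennreal (?A * ln (sqrt t / t)) \<le> (\<integral>\<^sup>+ r \<in> {t<..<sqrt t}.
        ennreal (\<omega> * r ^ (CARD('n) - 1)) * ennreal (c * r powr (- (2 * a)) * \<bar>ln r\<bar> powr (- \<beta>)) \<partial>lborel)"
      proof (rule nn_integral_ge_ln)
        fix s assume s: "t < s" "s < sqrt t"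
        have "s < 1" using s(2) t real_sqrt_less_iff[of t 1] by (simp del: real_sqrt_less_iff real_sqrt_lt_1_iff)
        then have 3: "\<bar>ln t\<bar> powr (- \<beta>) \<le> \<bar>ln s\<bar> powr (- \<beta>)" using s t by (intro ln_mono) auto
        then have "?A / s \<le> \<omega> * c * s powr (N - 2 * a) * \<bar>ln s\<bar> powr (- \<beta>) / s"
          using \<omega> c s t log by (intro divide_right_mono) (auto intro!: mult_left_mono)
        then show "ennreal (?A / s) \<le> ennreal (\<omega> * s ^ (CARD('n) - 1)) * ennreal (c * s powr (- (2 * a)) * \<bar>ln s\<bar> powr (- \<beta>))"
          using s t c by (subst integrand) (auto intro!: ennreal_leI)
      qed (use t tst \<omega> c in auto)
      also have "?A * ln (sqrt t / t) = \<omega> / 2 * c * t powr (N / 2) * weight a b t"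
      proof -
        have "ln (sqrt t / t) = \<bar>ln t\<bar> / 2" using t by (simp add: ln_div ln_sqrt)
        moreover have "\<bar>ln t\<bar> powr (- \<beta>) * \<bar>ln t\<bar> = \<bar>ln t\<bar> powr (- b)"
          using t by (simp add: log powr_diff powr_minus field_simps)
        moreover have "t powr (N / 2) * t powr (- a) = 1"
          using t by (simp add: log powr_minus)
        ultimately have "?A * ln (sqrt t / t) = \<omega> / 2 * c * (t powr (N / 2) * t powr (- a)) * \<bar>ln t\<bar> powr (- b)"
          by (simp only: mult.assoc mult_1_left mult_1_right times_divide_eq_right times_divide_eq_left)
        then show ?thesis by (simp add: weight_def mult_ac)
      qed
      finally show "ennreal (\<omega> / 2 * c * t powr (N / 2) * weight a b t) \<le> (\<integral>\<^sup>+ r \<in> {t<..<sqrt t}.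
        ennreal (\<omega> * r ^ (CARD('n) - 1)) * ennreal (c * r powr (- (2 * a)) * \<bar>ln r\<bar> powr (- \<beta>)) \<partial>lborel)" .
    qed (use \<omega> in auto)
  qed
  show ?thesis
  proof (intro exI[of _ "k * A"] conjI allI impI)
    show "0 < k * A" using k LA(1) by simp
    fix T t0 c d r and f :: "real ^ 'n \<Rightarrow> ennreal" and g w
    assume c: "0 < c" and t0: "t0 \<le> T" "t0 \<le> 1 / 4" and d: "0 < d" "t0 \<le> d\<^sup>2"
      and f: "\<forall>x. x \<noteq> 0 \<longrightarrow> norm x < d \<longrightarrow> ennreal (c * norm x powr (- (2 * a)) * \<bar>ln (norm x)\<bar> powr (- \<beta>)) \<le> f x"
      and duh: "duhamel_ge D r T (Function_Datum f) g w"
    let ?J = "\<lambda>t. if 0 < t \<and> t < 1 / 4 then {L t<..<sqrt t} else {}"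
    have "ge_on (parabola t0) (\<lambda>t. ennreal (k * t powr (- N / 2)) * (\<integral>\<^sup>+ r \<in> ?J t.
        ennreal (\<omega> * r ^ (CARD('n) - 1)) * ennreal (c * r powr (- (2 * a)) * \<bar>ln r\<bar> powr (- \<beta>)) \<partial>lborel)) w"
      using f LA(2) by (intro datum[OF t0(1) d(2,1) duh]) (auto, force)
    then show "ge_on (parabola t0) (\<lambda>t. ennreal (k * A * c * weight a b t)) w"
    proof (rule ge_on_mono)
      fix t assume "parabola t0 t \<noteq> ({} :: (real ^ 'n) set)"
      then have t: "0 < t" "t < 1 / 4" using t0 by (auto simp: parabola_def split: if_splits)
      have "k * A * c * weight a b t = k * t powr (- N / 2) * (A * c * t powr (N / 2) * weight a b t)"
        using t by (simp add: powr_minus)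
      then have "ennreal (k * A * c * weight a b t) = ennreal (k * t powr (- N / 2) * (A * c * t powr (N / 2) * weight a b t))"
        by (simp only:)
      also have "\<dots> = ennreal (k * t powr (- N / 2)) * ennreal (A * c * t powr (N / 2) * weight a b t)"
        using k by (intro ennreal_mult') auto
      also have "\<dots> \<le> ennreal (k * t powr (- N / 2)) * (\<integral>\<^sup>+ r \<in> ?J t.
          ennreal (\<omega> * r ^ (CARD('n) - 1)) * ennreal (c * r powr (- (2 * a)) * \<bar>ln r\<bar> powr (- \<beta>)) \<partial>lborel)"
        using LA(3)[OF t c] t by (intro mult_left_mono) auto
      finally show "ennreal (k * A * c * weight a b t) \<le> ennreal (k * t powr (- N / 2)) * (\<integral>\<^sup>+ r \<in> ?J t.
          ennreal (\<omega> * r ^ (CARD('n) - 1)) * ennreal (c * r powr (- (2 * a)) * \<bar>ln r\<bar> powr (- \<beta>)) \<partial>lborel)" .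
    qed simp
  qed
qed

text \<open>One round through both equations replaces \<open>L\<close> by \<open>C * L powr (r1 * r2)\<close>, which is at
  least \<open>2 * L\<close> as soon as \<open>C * L powr (r1 * r2 - 1) \<ge> 2\<close>; \<open>K\<close> is the value with equality.\<close>

lemma blow_up_from_large_weight:
  fixes D1 D2 r1 r2 a b a' b' :: real
  assumes D: "0 < D1" "0 < D2" and r: "0 < r1" "0 < r2" "1 < r1 * r2" and b: "0 \<le> b" "0 \<le> b'"
    and tr: "weight_transfer (real CARD('n::finite)) r1 a b a' b'" "weight_transfer (real CARD('n)) r2 a' b' a b"
  shows "\<exists>K>0. \<forall>T t0 L (\<mu> :: 'n initial_datum) \<nu> g w. K \<le> L \<longrightarrow> 0 < t0 \<longrightarrow> t0 \<le> T \<longrightarrow> t0 \<le> 1 / 4 \<longrightarrow>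
    duhamel_ge D1 r1 T \<mu> g w \<longrightarrow> duhamel_ge D2 r2 T \<nu> w g \<longrightarrow> finite_on T g \<longrightarrow>
    \<not> ge_on (parabola t0) (\<lambda>t. ennreal (L * weight a b t)) g"
proof -
  obtain C1 where C1: "0 < C1" "\<And>T t0 K (\<mu> :: 'n initial_datum) g w. 0 < K \<Longrightarrow> t0 \<le> T \<Longrightarrow> t0 \<le> 1 / 4 \<Longrightarrow>
    duhamel_ge D1 r1 T \<mu> g w \<Longrightarrow> ge_on (parabola t0) (\<lambda>t. ennreal (K * weight a b t)) g \<Longrightarrow>
    ge_on (parabola t0) (\<lambda>t. ennreal (C1 * K powr r1 * weight a' b' t)) w"
    using weight_step[OF D(1) r(1) b(1) tr(1)] by blast
  obtain C2 where C2: "0 < C2" "\<And>T t0 K (\<mu> :: 'n initial_datum) g w. 0 < K \<Longrightarrow> t0 \<le> T \<Longrightarrow> t0 \<le> 1 / 4 \<Longrightarrow>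
    duhamel_ge D2 r2 T \<mu> g w \<Longrightarrow> ge_on (parabola t0) (\<lambda>t. ennreal (K * weight a' b' t)) g \<Longrightarrow>
    ge_on (parabola t0) (\<lambda>t. ennreal (C2 * K powr r2 * weight a b t)) w"
    using weight_step[OF D(2) r(2) b(2) tr(2)] by blast
  define C where "C = C2 * C1 powr r2"
  have C: "0 < C" using C1(1) C2(1) by (simp add: C_def)
  define K where "K = (2 / C) powr (1 / (r1 * r2 - 1))"
  have K: "0 < K" using C by (simp add: K_def)
  have K_fixpoint: "C * K powr (r1 * r2 - 1) = 2" using r C by (simp add: K_def powr_powr)
  have doubling: "2 * L \<le> C2 * (C1 * L powr r1) powr r2" if L: "K \<le> L" for L
  proof -
    have "2 * L = C * K powr (r1 * r2 - 1) * L" by (simp add: K_fixpoint)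
    also have "\<dots> \<le> C * L powr (r1 * r2 - 1) * L"
      using C K L r by (intro mult_right_mono mult_left_mono powr_mono2) auto
    also have "\<dots> = C2 * (C1 * L powr r1) powr r2"
      using K L C1(1) by (simp add: C_def powr_mult powr_powr powr_diff)
    finally show ?thesis .
  qed
  show ?thesis
  proof (intro exI[of _ K] conjI K allI impI notI)
    fix T t0 L and \<mu> \<nu> :: "'n initial_datum" and g w
    assume L: "K \<le> L" and t0: "0 < t0" "t0 \<le> T" "t0 \<le> 1 / 4"
      and duh: "duhamel_ge D1 r1 T \<mu> g w" "duhamel_ge D2 r2 T \<nu> w g" and fin: "finite_on T g"
      and start: "ge_on (parabola t0) (\<lambda>t. ennreal (L * weight a b t)) g"
    have bound: "ge_on (parabola t0) (\<lambda>t. ennreal (2 ^ n * L * weight a b t)) g" for n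
    proof (induction n)
      case 0
      then show ?case using start by simp
    next
      case (Suc n)
      have "1 * L \<le> 2 ^ n * L" using K L by (intro mult_right_mono) auto
      then have Ln: "K \<le> 2 ^ n * L" using L by linarith
      then have Lpos: "0 < 2 ^ n * L" using K by linarith
      have "ge_on (parabola t0) (\<lambda>t. ennreal (C1 * (2 ^ n * L) powr r1 * weight a' b' t)) w"
        by (rule C1(2)[OF Lpos t0(2,3) duh(1) Suc])
      moreover have "0 < C1 * (2 ^ n * L) powr r1" using C1(1) Lpos by (intro mult_pos_pos) auto
      ultimately have "ge_on (parabola t0)
          (\<lambda>t. ennreal (C2 * (C1 * (2 ^ n * L) powr r1) powr r2 * weight a b t)) g"
        by (intro C2(2)[OF _ t0(2,3) duh(2)]) auto
      then show ?case
      proof (rule ge_on_mono)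
        fix t assume "parabola t0 t \<noteq> ({} :: (real ^ 'n) set)"
        then have "0 < weight a b t" using t0 by (auto simp: parabola_def intro!: weight_pos split: if_splits)
        then show "ennreal (2 ^ Suc n * L * weight a b t)
          \<le> ennreal (C2 * (C1 * (2 ^ n * L) powr r1) powr r2 * weight a b t)"
          using doubling[OF Ln] by (intro ennreal_leI mult_right_mono) auto
      qed simp
    qed
    show False
    proof (rule ge_on_unbounded_False[OF fin _ _ _ _ bound, where a = 0 and b = t0])
      fix t assume t: "0 < t" "t < t0"
      then have "0 < L * weight a b t" using K L t0 by (intro mult_pos_pos weight_pos) auto
      then have "filterlim (\<lambda>n. L * weight a b t * 2 ^ n) at_top sequentially"
        by (intro filterlim_tendsto_pos_mult_at_top[OF tendsto_const] filterlim_real_power_at_top) auto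
      then show "(SUP n. ennreal (2 ^ n * L * weight a b t)) = \<infinity>"
        by (intro SUP_ennreal_eq_infinity) (simp add: mult_ac)
      show "parabola t0 t \<in> sets borel \<and> emeasure lborel (parabola t0 t :: (real ^ 'n) set) \<noteq> 0"
        using t by (auto simp: parabola_def emeasure_ball_vec_neq_0)
    qed (use t0 in auto)
  qed
qed

lemma ge_near_0E:
  assumes "ge_near_0 f g"
  obtains d where "0 < d" "\<And>x. x \<noteq> 0 \<Longrightarrow> norm x < d \<Longrightarrow> ennreal (g x) \<le> f x"
  using assms unfolding ge_near_0_def eventually_at by (auto simp: dist_norm)

text \<open>The two unknowns enter symmetrically: a large constant in the profile of \<open>\<mu>\<close> starts
  the iteration at \<open>u\<close>, one in the profile of \<open>\<nu>\<close> starts it at \<open>v\<close>. The time \<open>t0\<close> depends on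
  the neighborhoods in which the profiles are given, the threshold \<open>K\<close> does not.\<close>

proposition critical_profile_nonexistence:
  fixes D1 D2 p q a b a' b' \<beta> \<beta>' :: real
  assumes D: "0 < D1" "0 < D2" and pq: "0 < p" "0 < q" "1 < p * q"
    and ab: "0 \<le> a" "0 \<le> b" "0 \<le> a'" "0 \<le> b'"
    and tr: "weight_transfer (real CARD('n::finite)) q a b a' b'" "weight_transfer (real CARD('n)) p a' b' a b"
    and \<beta>: "\<beta> = b \<or> (a = real CARD('n) / 2 \<and> \<beta> = b + 1)"
    and \<beta>': "\<beta>' = b' \<or> (a' = real CARD('n) / 2 \<and> \<beta>' = b' + 1)"
  shows "\<exists>K>0. \<forall>(\<mu> :: real ^ 'n \<Rightarrow> ennreal) (\<nu> :: real ^ 'n \<Rightarrow> ennreal) c1 c2.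
    0 < c1 \<and> 0 < c2 \<and>
    ge_near_0 \<mu> (\<lambda>x. c1 * norm x powr (- (2 * a)) * \<bar>ln (norm x)\<bar> powr (- \<beta>)) \<and>
    ge_near_0 \<nu> (\<lambda>x. c2 * norm x powr (- (2 * a')) * \<bar>ln (norm x)\<bar> powr (- \<beta>')) \<and>
    (K \<le> c1 \<or> K \<le> c2) \<longrightarrow>
    no_local_solutions D1 D2 p q (Function_Datum \<mu>) (Function_Datum \<nu>)"
proof -
  have pq': "1 < q * p" using pq by (simp add: mult.commute)
  obtain K1 where K1: "0 < K1" "\<And>T t0 L (\<mu> :: 'n initial_datum) \<nu> g w. K1 \<le> L \<Longrightarrow> 0 < t0 \<Longrightarrow> t0 \<le> T \<Longrightarrow> t0 \<le> 1 / 4 \<Longrightarrow>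
    duhamel_ge D2 q T \<mu> g w \<Longrightarrow> duhamel_ge D1 p T \<nu> w g \<Longrightarrow> finite_on T g \<Longrightarrow>
    \<not> ge_on (parabola t0) (\<lambda>t. ennreal (L * weight a b t)) g"
    using blow_up_from_large_weight[OF D(2,1) pq(2,1) pq' ab(2,4) tr] by blast
  obtain K2 where K2: "0 < K2" "\<And>T t0 L (\<mu> :: 'n initial_datum) \<nu> g w. K2 \<le> L \<Longrightarrow> 0 < t0 \<Longrightarrow> t0 \<le> T \<Longrightarrow> t0 \<le> 1 / 4 \<Longrightarrow>
    duhamel_ge D1 p T \<mu> g w \<Longrightarrow> duhamel_ge D2 q T \<nu> w g \<Longrightarrow> finite_on T g \<Longrightarrow>
    \<not> ge_on (parabola t0) (\<lambda>t. ennreal (L * weight a' b' t)) g"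
    using blow_up_from_large_weight[OF D pq ab(4,2) tr(2,1)] by blast
  obtain C1 where C1: "0 < C1" "\<And>T t0 c d r (f :: real ^ 'n \<Rightarrow> ennreal) g w. 0 < c \<Longrightarrow> t0 \<le> T \<Longrightarrow> t0 \<le> 1 / 4 \<Longrightarrow>
    0 < d \<Longrightarrow> t0 \<le> d\<^sup>2 \<Longrightarrow>
    (\<forall>x. x \<noteq> 0 \<longrightarrow> norm x < d \<longrightarrow> ennreal (c * norm x powr (- (2 * a)) * \<bar>ln (norm x)\<bar> powr (- \<beta>)) \<le> f x) \<Longrightarrow>
    duhamel_ge D1 r T (Function_Datum f) g w \<Longrightarrow>
    ge_on (parabola t0) (\<lambda>t. ennreal (C1 * c * weight a b t)) w"
    using weight_datum[OF D(1) ab(1,2) \<beta>] by metis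
  obtain C2 where C2: "0 < C2" "\<And>T t0 c d r (f :: real ^ 'n \<Rightarrow> ennreal) g w. 0 < c \<Longrightarrow> t0 \<le> T \<Longrightarrow> t0 \<le> 1 / 4 \<Longrightarrow>
    0 < d \<Longrightarrow> t0 \<le> d\<^sup>2 \<Longrightarrow>
    (\<forall>x. x \<noteq> 0 \<longrightarrow> norm x < d \<longrightarrow> ennreal (c * norm x powr (- (2 * a')) * \<bar>ln (norm x)\<bar> powr (- \<beta>')) \<le> f x) \<Longrightarrow>
    duhamel_ge D2 r T (Function_Datum f) g w \<Longrightarrow>
    ge_on (parabola t0) (\<lambda>t. ennreal (C2 * c * weight a' b' t)) w"
    using weight_datum[OF D(2) ab(3,4) \<beta>'] by metis
  define K where "K = max (K1 / C1) (K2 / C2)"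
  show ?thesis
  proof (intro exI[of _ K] conjI allI impI)
    show "0 < K" using K1(1) C1(1) by (simp add: K_def less_max_iff_disj)
    fix \<mu> \<nu> :: "real ^ 'n \<Rightarrow> ennreal" and c1 c2 :: real
    assume *: "0 < c1 \<and> 0 < c2 \<and>
      ge_near_0 \<mu> (\<lambda>x. c1 * norm x powr (- (2 * a)) * \<bar>ln (norm x)\<bar> powr (- \<beta>)) \<and>
      ge_near_0 \<nu> (\<lambda>x. c2 * norm x powr (- (2 * a')) * \<bar>ln (norm x)\<bar> powr (- \<beta>')) \<and>
      (K \<le> c1 \<or> K \<le> c2)"
    from * obtain d1 where d1: "0 < d1" "\<And>x. x \<noteq> 0 \<Longrightarrow> norm x < d1 \<Longrightarrow>
        ennreal (c1 * norm x powr (- (2 * a)) * \<bar>ln (norm x)\<bar> powr (- \<beta>)) \<le> \<mu> x"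
      by (auto elim: ge_near_0E)
    from * obtain d2 where d2: "0 < d2" "\<And>x. x \<noteq> 0 \<Longrightarrow> norm x < d2 \<Longrightarrow>
        ennreal (c2 * norm x powr (- (2 * a')) * \<bar>ln (norm x)\<bar> powr (- \<beta>')) \<le> \<nu> x"
      by (auto elim: ge_near_0E)
    show "no_local_solutions D1 D2 p q (Function_Datum \<mu>) (Function_Datum \<nu>)"
      unfolding no_local_solutions_def
    proof (intro notI, elim exE conjE)
      fix T u v
      assume T: "0 < T" and sol: "is_solution D1 D2 p q (Function_Datum \<mu>) (Function_Datum \<nu>) T u v"
      note duh = is_solutionD[OF sol]
      define t0 where "t0 = min (min T (1 / 4)) (min (d1\<^sup>2) (d2\<^sup>2))"
      have t0: "0 < t0" "t0 \<le> T" "t0 \<le> 1 / 4" "t0 \<le> d1\<^sup>2" "t0 \<le> d2\<^sup>2"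
        using T d1(1) d2(1) by (auto simp: t0_def)
      from * have "K1 \<le> C1 * c1 \<or> K2 \<le> C2 * c2"
        using C1(1) C2(1) by (auto simp: K_def field_simps)
      then show False
      proof
        assume "K1 \<le> C1 * c1"
        then show False
          using K1(2)[OF _ t0(1-3) duh(2,1,3)] C1(2)[OF _ t0(2,3) d1(1) t0(4) _ duh(1)] d1(2) * by blast
      next
        assume "K2 \<le> C2 * c2"
        then show False
          using K2(2)[OF _ t0(1-3) duh(1,2,4)] C2(2)[OF _ t0(2,3) d2(1) t0(5) _ duh(2)] d2(2) * by blast
      qed
    qed
  qed
qed

section \<open>Divergent Dini integrals\<close>

lemma ennpow_measurable [measurable]: "(\<lambda>x. ennpow x a) \<in> borel_measurable borel"
  unfolding ennpow_def by measurable

lemma ennpow_top [simp]: "ennpow top a = top"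
  by (simp add: ennpow_def)

text \<open>The relation \<open>e * q = N / 2 + 1\<close> makes the integrand in \<open>parabola_duhamel\<close> equal, up to
  a factor depending on \<open>t\<close>, to \<open>1 / s\<close> times the \<open>q\<close>-th power of \<open>H (sqrt s)\<close>, so that \<open>r = sqrt s\<close> turns it into the
  divergent integral.\<close>

lemma blow_up_from_divergent_dini:
  fixes H :: "real \<Rightarrow> ennreal" and u v :: "real ^ 'n::finite \<Rightarrow> real \<Rightarrow> ennreal"
  assumes D: "0 < D" and q: "0 < q" and e: "e * q = real CARD('n) / 2 + 1" and c: "0 < c"
    and t0: "0 < t0" "t0 \<le> T" "t0 \<le> 1"
    and H [measurable]: "H \<in> borel_measurable borel"
    and div: "\<And>\<rho>. 0 < \<rho> \<Longrightarrow> \<rho> < 1 \<Longrightarrow> (\<integral>\<^sup>+ r \<in> {0<..<\<rho>}. ennpow (H r) q * ennreal (1 / r) \<partial>lborel) = \<infinity>"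
    and u: "ge_on (parabola t0) (\<lambda>t. ennreal (c * t powr (- e)) * H (sqrt t)) u"
    and duh: "duhamel_ge D q T \<nu> u v" and fin: "finite_on T v"
  shows False
proof -
  define N where "N = real CARD('n)"
  define \<kappa> where "\<kappa> = kernel_const TYPE('n) D * unit_ball_vol N"
  have \<kappa>: "0 < \<kappa>"
    unfolding \<kappa>_def by (intro mult_pos_pos kernel_const_pos D unit_ball_vol_pos) (simp add: N_def)
  have "ge_on (parabola t0) (\<lambda>t. \<integral>\<^sup>+ s \<in> {0<..<t / 2}. ennreal (\<kappa> * t powr (- N / 2) * s powr (N / 2)) *
      ennpow (ennreal (c * s powr (- e)) * H (sqrt s)) q \<partial>lborel) v"
    unfolding \<kappa>_def N_def by (rule parabola_duhamel[OF D q t0(2) duh u]) auto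
  then have bound: "ge_on (parabola t0) (\<lambda>_. \<infinity>) v"
  proof (rule ge_on_mono)
    fix t assume "parabola t0 t \<noteq> ({} :: (real ^ 'n) set)"
    then have t: "0 < t" "t < t0" by (auto simp: parabola_def split: if_splits)
    (* the range of r = sqrt s for s below t / 2 *)
    define \<rho> where "\<rho> = sqrt (t / 2)"
    have \<rho>: "0 < \<rho>" "\<rho> < 1" using t t0 by (auto simp: \<rho>_def)
    define G where "G r = ennpow (H r) q * ennreal (1 / r\<^sup>2) * indicator {0<..<\<rho>} r" for r
    have G [measurable]: "G \<in> borel_measurable borel" unfolding G_def by measurable
    define k where "k = \<kappa> * t powr (- N / 2) * c powr q"
    have k: "0 < k" using \<kappa> c t by (simp add: k_def)
    have dini: "ennreal (2 * r) * (ennpow (H r) q * ennreal (1 / r\<^sup>2) * indicator {0<..<\<rho>} r) * indicator {0<..} r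
        = 2 * (ennpow (H r) q * ennreal (1 / r) * indicator {0<..<\<rho>} r)" for r
    proof (cases "0 < r \<and> r < \<rho>")
      case True
      have "ennreal (2 * r) * ennreal (1 / r\<^sup>2) = 2 * ennreal (1 / r)"
        using True by (simp add: ennreal_mult'[symmetric] power2_eq_square flip: ennreal_numeral)
      then show ?thesis using True by (simp add: mult_ac)
    qed (auto simp: indicator_def)
    have "(\<infinity> :: ennreal) = ennreal k * (2 * (\<integral>\<^sup>+ r \<in> {0<..<\<rho>}. ennpow (H r) q * ennreal (1 / r) \<partial>lborel))"
      using k div[OF \<rho>] by (simp add: ennreal_mult_top)
    also have "2 * (\<integral>\<^sup>+ r \<in> {0<..<\<rho>}. ennpow (H r) q * ennreal (1 / r) \<partial>lborel)
        = (\<integral>\<^sup>+ r \<in> {0<..}. ennreal (2 * r) * G r \<partial>lborel)"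
      by (subst nn_integral_cmult[symmetric]) (auto simp: G_def dini)
    also have "\<dots> = (\<integral>\<^sup>+ s \<in> {0<..}. G (sqrt s) \<partial>lborel)"
      by (rule nn_integral_sqrt_substitution[OF G, symmetric])
    also have "ennreal k * \<dots> = (\<integral>\<^sup>+ s. ennreal k * (G (sqrt s) * indicator {0<..} s) \<partial>lborel)"
      by (subst nn_integral_cmult) auto
    also have "\<dots> \<le> (\<integral>\<^sup>+ s \<in> {0<..<t / 2}. ennreal (\<kappa> * t powr (- N / 2) * s powr (N / 2)) *
        ennpow (ennreal (c * s powr (- e)) * H (sqrt s)) q \<partial>lborel)"
    proof (intro nn_integral_mono)
      fix s :: real
      show "ennreal k * (G (sqrt s) * indicator {0<..} s)
        \<le> ennreal (\<kappa> * t powr (- N / 2) * s powr (N / 2)) *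
          ennpow (ennreal (c * s powr (- e)) * H (sqrt s)) q * indicator {0<..<t / 2} s"
      proof (cases "0 < s \<and> sqrt s < \<rho>")
        case True
        then have s: "0 < s" "s < t / 2" by (auto simp: \<rho>_def)
        have "s powr (N / 2) * (c * s powr (- e)) powr q = c powr q * (1 / s)"
        proof -
          have "s powr (N / 2) * s powr (- (e * q)) = 1 / s"
            using s powr_add[of s "N / 2" "- (e * q)"] by (simp add: e N_def powr_minus_divide)
          then show ?thesis using s c by (simp add: powr_mult powr_powr mult_ac)
        qed
        then have "\<kappa> * t powr (- N / 2) * s powr (N / 2) * (c * s powr (- e)) powr q
            = \<kappa> * t powr (- N / 2) * (c powr q * (1 / s))"
          by (simp only: mult.assoc)
        also have "\<dots> = k * (1 / s)" by (simp add: k_def)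
        finally have "\<kappa> * t powr (- N / 2) * s powr (N / 2) * (c * s powr (- e)) powr q = k * (1 / s)" .
        then have "ennreal (\<kappa> * t powr (- N / 2) * s powr (N / 2)) * ennreal ((c * s powr (- e)) powr q)
            = ennreal k * ennreal (1 / s)"
          using \<kappa> k by (simp only: ennreal_mult'[symmetric] powr_ge_zero mult_nonneg_nonneg less_imp_le)
        moreover have "ennpow (ennreal (c * s powr (- e)) * H (sqrt s)) q
            = ennreal ((c * s powr (- e)) powr q) * ennpow (H (sqrt s)) q"
          using s c q by (intro ennpow_cmult) auto
        ultimately have "ennreal (\<kappa> * t powr (- N / 2) * s powr (N / 2)) * ennpow (ennreal (c * s powr (- e)) * H (sqrt s)) q
            = ennreal k * ennreal (1 / s) * ennpow (H (sqrt s)) q"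
          by (simp only: mult.assoc[symmetric])
        moreover have "G (sqrt s) = ennpow (H (sqrt s)) q * ennreal (1 / s)"
          using s True by (simp add: G_def)
        ultimately show ?thesis using s by (simp add: mult_ac)
      qed (auto simp: G_def indicator_def)
    qed
    finally show "\<infinity> \<le> (\<integral>\<^sup>+ s \<in> {0<..<t / 2}. ennreal (\<kappa> * t powr (- N / 2) * s powr (N / 2)) *
        ennpow (ennreal (c * s powr (- e)) * H (sqrt s)) q \<partial>lborel)" .
  qed simp
  show False
  proof (rule ge_on_unbounded_False[OF fin, where a = 0 and b = t0 and F = "\<lambda>_ _. \<infinity>"])
    show "ge_on (parabola t0) (\<lambda>_. \<infinity>) v" by (rule bound)
  qed (use t0 in \<open>auto simp: parabola_def emeasure_ball_vec_neq_0\<close>)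
qed

lemma nn_integral_continuous_finite:
  fixes f :: "real \<Rightarrow> real"
  assumes f: "continuous_on {0<..1} f" and \<rho>: "0 < \<rho>" "\<rho> \<le> b" "b \<le> 1"
  shows "(\<integral>\<^sup>+ r \<in> {\<rho>..<b}. ennreal (f r) \<partial>lborel) < \<infinity>"
proof -
  have "bounded (f ` {\<rho>..b})"
    using \<rho> by (intro compact_imp_bounded compact_continuous_image continuous_on_subset[OF f]) auto
  then obtain B where B: "\<forall>r \<in> {\<rho>..b}. \<bar>f r\<bar> \<le> B"
    by (auto simp: bounded_iff)
  have "(\<integral>\<^sup>+ r \<in> {\<rho>..<b}. ennreal (f r) \<partial>lborel) \<le> (\<integral>\<^sup>+ r. ennreal B * indicator {\<rho>..<b} r \<partial>lborel)"
    using B by (intro nn_integral_mono) (force simp: indicator_def intro!: ennreal_leI)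
  also have "\<dots> < \<infinity>" using \<rho> by (simp add: nn_integral_cmult_indicator ennreal_mult_less_top)
  finally show ?thesis .
qed

lemma nn_integral_split_at:
  fixes f :: "real \<Rightarrow> ennreal"
  assumes f: "(\<lambda>r. f r * indicator {0<..<b} r) \<in> borel_measurable borel" and \<rho>: "0 < \<rho>" "\<rho> \<le> b"
  shows "(\<integral>\<^sup>+ r \<in> {0<..<b}. f r \<partial>lborel) = (\<integral>\<^sup>+ r \<in> {0<..<\<rho>}. f r \<partial>lborel) + (\<integral>\<^sup>+ r \<in> {\<rho>..<b}. f r \<partial>lborel)"
proof -
  let ?f = "\<lambda>r. f r * indicator {0<..<b} r"
  have "?f r = ?f r * indicator {0<..<\<rho>} r + ?f r * indicator {\<rho>..<b} r" for r
    using \<rho> by (auto simp: indicator_def)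
  then have "(\<integral>\<^sup>+ r \<in> {0<..<b}. f r \<partial>lborel) = (\<integral>\<^sup>+ r. ?f r * indicator {0<..<\<rho>} r + ?f r * indicator {\<rho>..<b} r \<partial>lborel)"
    by (rule nn_integral_cong)
  also have "\<dots> = (\<integral>\<^sup>+ r. ?f r * indicator {0<..<\<rho>} r \<partial>lborel) + (\<integral>\<^sup>+ r. ?f r * indicator {\<rho>..<b} r \<partial>lborel)"
    using f by (intro nn_integral_add) auto
  also have "(\<integral>\<^sup>+ r. ?f r * indicator {0<..<\<rho>} r \<partial>lborel) = (\<integral>\<^sup>+ r \<in> {0<..<\<rho>}. f r \<partial>lborel)"
    using \<rho> by (intro nn_integral_cong) (auto simp: indicator_def)
  also have "(\<integral>\<^sup>+ r. ?f r * indicator {\<rho>..<b} r \<partial>lborel) = (\<integral>\<^sup>+ r \<in> {\<rho>..<b}. f r \<partial>lborel)"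
    using \<rho> by (intro nn_integral_cong) (auto simp: indicator_def)
  finally show ?thesis .
qed

lemma pos_cont_indicator_measurable:
  assumes "pos_cont h"
  shows "(\<lambda>r. h r * indicator {0<..1} r) \<in> borel_measurable borel"
  using assms borel_measurable_continuous_on_indicator[of "{0<..1}" h]
  by (simp add: pos_cont_def mult.commute)

text \<open>Monotonicity gives \<open>h r \<ge> 2 powr (- \<epsilon>) * h (sqrt t)\<close> for \<open>r\<close> between
  \<open>sqrt t / 2\<close> and \<open>sqrt t\<close>, so a single shell shows that \<open>u\<close> is at least of order
  \<open>t powr (- e) * h (sqrt t)\<close> on the parabola, with \<open>e = (N + 2) / (2 * q)\<close>.\<close>

proposition divergent_supercritical_profile_nonexistence:
  fixes \<mu> :: "real ^ 'n::finite \<Rightarrow> ennreal" and h :: "real \<Rightarrow> real"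
  assumes D: "0 < D1" "0 < D2" and q: "0 < q" and T: "0 < T"
    and h: "pos_cont h" and eps: "0 < \<epsilon>" "0 < \<delta>" "antimono_on {0<..<\<delta>} (\<lambda>s. s powr (- \<epsilon>) * h s)"
    and \<mu>: "ge_near_0 \<mu> (\<lambda>x. norm x powr (- ((real CARD('n) + 2) / q)) * h (norm x))"
    and div: "(\<integral>\<^sup>+ r \<in> {0<..<1}. ennreal (r powr (- 1) * h r powr q) \<partial>lborel) = \<infinity>"
    and duh: "duhamel_ge D1 p T (Function_Datum \<mu>) v u" "duhamel_ge D2 q T \<nu> u v" "finite_on T v"
  shows False
proof -
  obtain d where d: "0 < d" "\<And>x. x \<noteq> 0 \<Longrightarrow> norm x < d \<Longrightarrow>
      ennreal (norm x powr (- ((real CARD('n) + 2) / q)) * h (norm x)) \<le> \<mu> x"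
    using ge_near_0E[OF \<mu>] by blast
  define N where "N = real CARD('n)"
  define e where "e = (N + 2) / (2 * q)"
  have e: "0 < e" "e * q = N / 2 + 1" "(N + 2) / q = 2 * e"
    using q by (auto simp: e_def N_def field_simps intro!: divide_pos_pos)
  define \<omega> where "\<omega> = unit_ball_vol N * N"
  have \<omega>: "0 < \<omega>" by (simp add: \<omega>_def N_def)
  define k where "k = kernel_const TYPE('n) D1"
  have k: "0 < k" using kernel_const_pos[OF D(1)] by (simp add: k_def)
  define d' where "d' = min (min d \<delta>) 1"
  have d': "0 < d'" "d' \<le> d" "d' \<le> \<delta>" "d' \<le> 1" using d(1) eps(2) by (auto simp: d'_def)
  define t0 where "t0 = min T (d'\<^sup>2)"
  have t0: "0 < t0" "t0 \<le> T" "t0 \<le> d'\<^sup>2" using T d' by (auto simp: t0_def)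
  have "d'\<^sup>2 \<le> 1" using d' by (simp add: power_le_one)
  then have t01: "t0 \<le> 1" using t0 by linarith
  define c where "c = k * \<omega> * 2 powr (- N) * ln 2 * 2 powr (- \<epsilon>)"
  have c: "0 < c" using k \<omega> by (simp add: c_def)
  define H where "H r = ennreal (h r * indicator {0<..1} r)" for r
  have h' [measurable]: "(\<lambda>r. h r * indicator {0<..1} r) \<in> borel_measurable borel"
    by (rule pos_cont_indicator_measurable[OF h])
  have H [measurable]: "H \<in> borel_measurable borel" unfolding H_def by measurable
  have h_pos: "0 < h r" if "0 < r" "r \<le> 1" for r using h that by (simp add: pos_cont_def)
  show False
  proof (rule blow_up_from_divergent_dini[OF D(2) q e(2)[unfolded N_def] c t0(1,2) t01 H _ _ duh(2,3)])
    fix \<rho> :: real assume \<rho>: "0 < \<rho>" "\<rho> < 1"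
    have cont: "continuous_on {0<..1} (\<lambda>r. r powr (- 1) * h r powr q)"
      using h h_pos by (intro continuous_intros) (auto simp: pos_cont_def less_imp_neq[symmetric])
    have eq: "ennpow (H r) q * ennreal (1 / r) = ennreal (r powr (- 1) * h r powr q)" if "0 < r" "r < 1" for r
      using that h_pos[of r] by (simp add: H_def ennpow_ennreal ennreal_mult'[symmetric] powr_minus_divide)
    have "(\<lambda>r. ennreal (r powr (- 1) * h r powr q) * indicator {0<..<1} r) \<in> borel_measurable borel"
    proof -
      have "(\<lambda>r. ennreal (r powr (- 1) * h r powr q) * indicator {0<..<1} r)
          = (\<lambda>r. ennreal (r powr (- 1) * (h r * indicator {0<..1} r) powr q) * indicator {0<..<1} r)"
        by (auto simp: indicator_def fun_eq_iff)
      also have "\<dots> \<in> borel_measurable borel" by measurable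
      finally show ?thesis .
    qed
    from nn_integral_split_at[OF this, of \<rho>] div \<rho> nn_integral_continuous_finite[OF cont, of \<rho> 1]
    have "(\<integral>\<^sup>+ r \<in> {0<..<\<rho>}. ennreal (r powr (- 1) * h r powr q) \<partial>lborel) = \<infinity>"
      by (auto simp: ennreal_add_eq_top)
    also have "(\<integral>\<^sup>+ r \<in> {0<..<\<rho>}. ennreal (r powr (- 1) * h r powr q) \<partial>lborel)
        = (\<integral>\<^sup>+ r \<in> {0<..<\<rho>}. ennpow (H r) q * ennreal (1 / r) \<partial>lborel)"
      using \<rho> eq by (intro nn_integral_cong) (auto simp: indicator_def)
    finally show "(\<integral>\<^sup>+ r \<in> {0<..<\<rho>}. ennpow (H r) q * ennreal (1 / r) \<partial>lborel) = \<infinity>" .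
  next
    let ?h = "\<lambda>s. ennreal (s powr (- (2 * e)) * h s)"
    have meas: "(\<lambda>s. ?h s * indicator {0<..<d'} s) \<in> borel_measurable borel"
    proof -
      have "(\<lambda>s. ?h s * indicator {0<..<d'} s)
          = (\<lambda>s. ennreal (s powr (- (2 * e)) * (h s * indicator {0<..1} s)) * indicator {0<..<d'} s)"
        using d' by (auto simp: indicator_def fun_eq_iff)
      also have "\<dots> \<in> borel_measurable borel" by measurable
      finally show ?thesis .
    qed
    have "ge_on (parabola t0) (\<lambda>t. ennreal (k * t powr (- N / 2)) * (\<integral>\<^sup>+ r \<in> {sqrt t / 2<..<sqrt t}.
        ennreal (\<omega> * r ^ (CARD('n) - 1)) * ?h r \<partial>lborel)) u"
      unfolding k_def N_def \<omega>_def
    proof (rule parabola_datum[OF D(1) t0(2,3) d'(1) duh(1) _ meas])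
      show "ennreal (norm x powr (- (2 * e)) * h (norm x)) \<le> \<mu> x" if "x \<noteq> 0" "norm x < d'" for x
        using d(2)[of x] that d' by (simp add: e(3)[unfolded N_def])
      show "{sqrt t / 2<..<sqrt t} \<subseteq> {0<..<sqrt t}" for t :: real
      proof
        fix r assume "r \<in> {sqrt t / 2<..<sqrt t}"
        then show "r \<in> {0<..<sqrt t}" by simp
      qed
    qed simp
    then show "ge_on (parabola t0) (\<lambda>t. ennreal (c * t powr (- e)) * H (sqrt t)) u"
    proof (rule ge_on_mono)
      fix t assume "parabola t0 t \<noteq> ({} :: (real ^ 'n) set)"
      then have t: "0 < t" "t < t0" by (auto simp: parabola_def split: if_splits)
      have st: "0 < sqrt t" "sqrt t < d'" using t t0 d' by (auto intro!: real_less_lsqrt)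
      have hst: "0 < h (sqrt t)" using st d' t t01 by (intro h_pos) auto
      let ?m = "t powr (- e) * (2 powr (- \<epsilon>) * h (sqrt t))"
      have m: "0 \<le> ?m" using hst by simp
      have "c * t powr (- e) * h (sqrt t) = k * t powr (- N / 2) * (\<omega> * 2 powr (- N) * ln 2 * t powr (N / 2) * ?m)"
        using t by (simp add: c_def powr_minus)
      moreover have "ennreal (c * t powr (- e)) * H (sqrt t) = ennreal (c * t powr (- e) * h (sqrt t))"
      proof -
        have "H (sqrt t) = ennreal (h (sqrt t))" using st d' t t01 by (simp add: H_def)
        then show ?thesis using c by (simp add: ennreal_mult')
      qed
      ultimately have "ennreal (c * t powr (- e)) * H (sqrt t)
          = ennreal (k * t powr (- N / 2) * (\<omega> * 2 powr (- N) * ln 2 * t powr (N / 2) * ?m))"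
        by (simp only:)
      also have "\<dots> = ennreal (k * t powr (- N / 2)) * ennreal (\<omega> * 2 powr (- N) * ln 2 * t powr (N / 2) * ?m)"
        using k by (intro ennreal_mult') auto
      also have "\<dots> \<le> ennreal (k * t powr (- N / 2)) * (\<integral>\<^sup>+ r \<in> {sqrt t / 2<..<sqrt t}.
        ennreal (\<omega> * r ^ (CARD('n) - 1)) * ?h r \<partial>lborel)"
      proof (rule mult_left_mono)
        show "ennreal (\<omega> * 2 powr (- N) * ln 2 * t powr (N / 2) * ?m) \<le> (\<integral>\<^sup>+ r \<in> {sqrt t / 2<..<sqrt t}.
          ennreal (\<omega> * r ^ (CARD('n) - 1)) * ?h r \<partial>lborel)"
          unfolding N_def
        proof (rule annulus_integral_ge)
          fix r assume r: "sqrt t / 2 < r" "r < sqrt t"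
          have r0: "0 < r" using r st by linarith
          have "t powr (- e) = sqrt t powr (- (2 * e))"
            using t by (simp add: powr_half_sqrt[symmetric] powr_powr)
          also have "\<dots> \<le> r powr (- (2 * e))" using r r0 e(1) by (intro powr_mono2') auto
          finally have 1: "t powr (- e) \<le> r powr (- (2 * e))" .
          have "sqrt t powr (- \<epsilon>) * h (sqrt t) \<le> r powr (- \<epsilon>) * h r"
            using eps(3) r r0 st d' by (auto simp: monotone_on_def)
          then have "r powr \<epsilon> * (sqrt t powr (- \<epsilon>) * h (sqrt t)) \<le> r powr \<epsilon> * (r powr (- \<epsilon>) * h r)"
            by (rule mult_left_mono) simp
          also have "\<dots> = h r" using r0 by (simp add: powr_minus)
          finally have "(r powr \<epsilon> * sqrt t powr (- \<epsilon>)) * h (sqrt t) \<le> h r" by (simp add: mult_ac)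
          moreover have "2 powr (- \<epsilon>) \<le> r powr \<epsilon> * sqrt t powr (- \<epsilon>)"
          proof -
            have "2 powr (- \<epsilon>) * sqrt t powr \<epsilon> = (sqrt t / 2) powr \<epsilon>"
              using st by (simp add: powr_divide powr_minus field_simps)
            also have "\<dots> \<le> r powr \<epsilon>" using r st eps by (intro powr_mono2) auto
            finally show ?thesis using st by (simp add: powr_minus field_simps)
          qed
          then have "2 powr (- \<epsilon>) * h (sqrt t) \<le> (r powr \<epsilon> * sqrt t powr (- \<epsilon>)) * h (sqrt t)"
            using hst by (intro mult_right_mono) auto
          ultimately have "2 powr (- \<epsilon>) * h (sqrt t) \<le> h r" by linarith
          with 1 show "?m \<le> r powr (- (2 * e)) * h r"
            using hst by (intro mult_mono) auto
        qed (use t \<omega> m in auto)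
      qed simp
      finally show "ennreal (c * t powr (- e)) * H (sqrt t) \<le> ennreal (k * t powr (- N / 2)) *
        (\<integral>\<^sup>+ r \<in> {sqrt t / 2<..<sqrt t}. ennreal (\<omega> * r ^ (CARD('n) - 1)) * ?h r \<partial>lborel)" .
    qed simp
  qed
qed

text \<open>In polar coordinates the mass of \<open>\<mu>\<close> in the ball of radius \<open>sqrt t\<close> is a multiple
  of the inner integral \<open>H (sqrt t)\<close>. That integral may be infinite; then it is so for all positive
  upper limits, because \<open>h\<close> is bounded on compact subsets of \<open>{0<..1}\<close>.\<close>

proposition divergent_critical_profile_nonexistence:
  fixes \<mu> :: "real ^ 'n::finite \<Rightarrow> ennreal" and h :: "real \<Rightarrow> real"
  assumes D: "0 < D1" "0 < D2" and q: "q = 1 + 2 / real CARD('n)" and T: "0 < T"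
    and h: "pos_cont h"
    and \<mu>: "ge_near_0 \<mu> (\<lambda>x. norm x powr (- real CARD('n)) * h (norm x))"
    and div: "(\<integral>\<^sup>+ r \<in> {0<..<1}. ennpow (\<integral>\<^sup>+ \<tau> \<in> {0<..<r}. ennreal (\<tau> powr (- 1) * h \<tau>) \<partial>lborel) q
      * ennreal (r powr (- 1)) \<partial>lborel) = \<infinity>"
    and duh: "duhamel_ge D1 p T (Function_Datum \<mu>) v u" "duhamel_ge D2 q T \<nu> u v" "finite_on T v"
  shows False
proof -
  obtain d where d: "0 < d" "\<And>x. x \<noteq> 0 \<Longrightarrow> norm x < d \<Longrightarrow>
      ennreal (norm x powr (- real CARD('n)) * h (norm x)) \<le> \<mu> x"
    using ge_near_0E[OF \<mu>] by blast
  define N where "N = real CARD('n)"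
  have N: "0 < N" by (simp add: N_def)
  have q0: "0 < q" using N by (simp add: q add_pos_nonneg)
  have eq_e: "N / 2 * q = N / 2 + 1" using N by (simp add: q N_def[symmetric] field_simps)
  define \<omega> where "\<omega> = unit_ball_vol N * N"
  have \<omega>: "0 < \<omega>" by (simp add: \<omega>_def N_def)
  define k where "k = kernel_const TYPE('n) D1"
  have k: "0 < k" using kernel_const_pos[OF D(1)] by (simp add: k_def)
  define d' where "d' = min d 1"
  have d': "0 < d'" "d' \<le> d" "d' \<le> 1" using d(1) by (auto simp: d'_def)
  define t0 where "t0 = min T (d'\<^sup>2)"
  have t0: "0 < t0" "t0 \<le> T" "t0 \<le> d'\<^sup>2" using T d' by (auto simp: t0_def)
  have "d'\<^sup>2 \<le> 1" using d' by (simp add: power_le_one)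
  then have t01: "t0 \<le> 1" using t0 by linarith
  have h' [measurable]: "(\<lambda>r. h r * indicator {0<..1} r) \<in> borel_measurable borel"
    by (rule pos_cont_indicator_measurable[OF h])
  define f where "f \<tau> = ennreal (\<tau> powr (- 1) * (h \<tau> * indicator {0<..1} \<tau>))" for \<tau>
  have f [measurable]: "f \<in> borel_measurable borel" unfolding f_def by measurable
  define H where "H r = (\<integral>\<^sup>+ \<tau>. (if 0 < \<tau> \<and> \<tau> < r then f \<tau> else 0) \<partial>lborel)" for r
  have H [measurable]: "H \<in> borel_measurable borel" unfolding H_def by measurable
  have H_eq: "H r = (\<integral>\<^sup>+ \<tau> \<in> {0<..<r}. f \<tau> \<partial>lborel)" for r
    unfolding H_def by (intro nn_integral_cong) (auto simp: indicator_def)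
  have H_h: "H r = (\<integral>\<^sup>+ \<tau> \<in> {0<..<r}. ennreal (\<tau> powr (- 1) * h \<tau>) \<partial>lborel)" if "r \<le> 1" for r
    unfolding H_eq using that by (intro nn_integral_cong) (auto simp: f_def indicator_def)
  have cont: "continuous_on {0<..1} (\<lambda>r. r powr (- 1) * h r)"
    using h by (intro continuous_intros) (auto simp: pos_cont_def)
  have f_fin: "(\<integral>\<^sup>+ \<tau> \<in> {\<rho>..<b}. f \<tau> \<partial>lborel) < \<infinity>" if "0 < \<rho>" "\<rho> \<le> b" "b \<le> 1" for \<rho> b
  proof -
    have "(\<integral>\<^sup>+ \<tau> \<in> {\<rho>..<b}. f \<tau> \<partial>lborel) = (\<integral>\<^sup>+ \<tau> \<in> {\<rho>..<b}. ennreal (\<tau> powr (- 1) * h \<tau>) \<partial>lborel)"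
      using that by (intro nn_integral_cong) (auto simp: f_def indicator_def)
    then show ?thesis using nn_integral_continuous_finite[OF cont that] by simp
  qed
  have H_split: "H b = H \<rho> + (\<integral>\<^sup>+ \<tau> \<in> {\<rho>..<b}. f \<tau> \<partial>lborel)" if "0 < \<rho>" "\<rho> \<le> b" for \<rho> b
    unfolding H_eq by (intro nn_integral_split_at that) auto
  have dini: "(\<integral>\<^sup>+ r \<in> {0<..<\<rho>}. ennpow (H r) q * ennreal (1 / r) \<partial>lborel) = \<infinity>"
    if \<rho>: "0 < \<rho>" "\<rho> < 1" for \<rho>
  proof (cases "H \<rho> = \<infinity>")
    case True
    have "H r = \<infinity>" if "0 < r" "r < \<rho>" for r
    proof -
      have "H r + (\<integral>\<^sup>+ \<tau> \<in> {r..<\<rho>}. f \<tau> \<partial>lborel) = \<infinity>"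
        using H_split[of r \<rho>] that True by simp
      then show ?thesis using f_fin[of r \<rho>] that \<rho> by (auto simp: ennreal_add_eq_top)
    qed
    then have "(\<integral>\<^sup>+ r \<in> {0<..<\<rho>}. ennpow (H r) q * ennreal (1 / r) \<partial>lborel)
        = (\<integral>\<^sup>+ r. \<infinity> * indicator {0<..<\<rho>} r \<partial>lborel)"
      by (intro nn_integral_cong) (auto simp: indicator_def ennreal_top_mult)
    also have "\<dots> = \<infinity>" using \<rho> by (subst nn_integral_cmult_indicator) (auto simp: ennreal_top_mult)
    finally show ?thesis .
  next
    case False
    then have H1: "H 1 < \<infinity>"
      using H_split[of \<rho> 1] f_fin[of \<rho> 1] \<rho> by (auto simp: less_top)
    have "(\<integral>\<^sup>+ r \<in> {\<rho>..<1}. ennpow (H r) q * ennreal (1 / r) \<partial>lborel)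
        \<le> (\<integral>\<^sup>+ r. ennpow (H 1) q * ennreal (1 / \<rho>) * indicator {\<rho>..<1} r \<partial>lborel)"
    proof (intro nn_integral_mono)
      fix r :: real
      show "ennpow (H r) q * ennreal (1 / r) * indicator {\<rho>..<1} r
        \<le> ennpow (H 1) q * ennreal (1 / \<rho>) * indicator {\<rho>..<1} r"
      proof (cases "r \<in> {\<rho>..<1}")
        case True
        then have "H r \<le> H 1" using H_split[of r 1] \<rho> by simp
        then show ?thesis using True \<rho> q0
          by (auto intro!: mult_mono ennpow_mono ennreal_leI divide_left_mono)
      qed simp
    qed
    also have "\<dots> < \<infinity>"
      using H1 \<rho> by (cases "H 1") (auto simp: nn_integral_cmult_indicator ennreal_mult_less_top ennpow_ennreal)
    finally have fin: "(\<integral>\<^sup>+ r \<in> {\<rho>..<1}. ennpow (H r) q * ennreal (1 / r) \<partial>lborel) < \<infinity>" .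
    have "(\<integral>\<^sup>+ r \<in> {0<..<1}. ennpow (H r) q * ennreal (1 / r) \<partial>lborel) = \<infinity>"
      unfolding div[symmetric]
      by (intro nn_integral_cong) (auto simp: indicator_def H_h powr_minus_divide)
    moreover have "(\<integral>\<^sup>+ r \<in> {0<..<1}. ennpow (H r) q * ennreal (1 / r) \<partial>lborel)
      = (\<integral>\<^sup>+ r \<in> {0<..<\<rho>}. ennpow (H r) q * ennreal (1 / r) \<partial>lborel)
        + (\<integral>\<^sup>+ r \<in> {\<rho>..<1}. ennpow (H r) q * ennreal (1 / r) \<partial>lborel)"
      using \<rho> by (intro nn_integral_split_at) auto
    ultimately show ?thesis using fin by (auto simp: ennreal_add_eq_top)
  qed
  let ?h = "\<lambda>s. ennreal (s powr (- N) * h s)"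
  have meas: "(\<lambda>s. ?h s * indicator {0<..<d'} s) \<in> borel_measurable borel"
  proof -
    have "(\<lambda>s. ?h s * indicator {0<..<d'} s)
        = (\<lambda>s. ennreal (s powr (- N) * (h s * indicator {0<..1} s)) * indicator {0<..<d'} s)"
      using d' by (auto simp: indicator_def fun_eq_iff)
    also have "\<dots> \<in> borel_measurable borel" by measurable
    finally show ?thesis .
  qed
  have "ge_on (parabola t0) (\<lambda>t. ennreal (k * t powr (- N / 2)) * (\<integral>\<^sup>+ r \<in> {0<..<sqrt t}.
      ennreal (\<omega> * r ^ (CARD('n) - 1)) * ?h r \<partial>lborel)) u"
    unfolding k_def N_def \<omega>_def
    by (rule parabola_datum[OF D(1) t0(2,3) d'(1) duh(1) _ meas[unfolded N_def]]) (use d d' in auto)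
  then have u: "ge_on (parabola t0) (\<lambda>t. ennreal (k * \<omega> * t powr (- (N / 2))) * H (sqrt t)) u"
  proof (rule ge_on_mono)
    fix t assume "parabola t0 t \<noteq> ({} :: (real ^ 'n) set)"
    then have t: "0 < t" "t < t0" by (auto simp: parabola_def split: if_splits)
    have st: "0 < sqrt t" "sqrt t < d'" using t t0 d' by (auto intro!: real_less_lsqrt)
    have "ennreal (\<omega> * r ^ (CARD('n) - 1)) * ?h r = ennreal \<omega> * f r" if "0 < r" "r < sqrt t" for r
    proof -
      have "r ^ (CARD('n) - 1) * r = r powr N"
        using that power_minus_mult[of "CARD('n)" r] by (simp add: N_def powr_realpow)
      then have "r ^ (CARD('n) - 1) * r powr (- N) = r powr (- 1)"
        using that by (simp add: powr_minus field_simps)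
      then have "\<omega> * r ^ (CARD('n) - 1) * (r powr (- N) * h r) = \<omega> * (r powr (- 1) * h r)"
        by (metis mult.assoc)
      moreover have "f r = ennreal (r powr (- 1) * h r)" using that st d' by (simp add: f_def)
      ultimately show ?thesis using \<omega> that by (simp only: ennreal_mult'[symmetric] less_imp_le mult_nonneg_nonneg zero_le_power)
    qed
    then have "(\<integral>\<^sup>+ r \<in> {0<..<sqrt t}. ennreal (\<omega> * r ^ (CARD('n) - 1)) * ?h r \<partial>lborel)
        = (\<integral>\<^sup>+ r. ennreal \<omega> * (f r * indicator {0<..<sqrt t} r) \<partial>lborel)"
      by (intro nn_integral_cong) (auto simp: indicator_def)
    also have "\<dots> = ennreal \<omega> * H (sqrt t)"
      unfolding H_eq by (rule nn_integral_cmult) auto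
    finally have "ennreal (k * t powr (- N / 2)) * (\<integral>\<^sup>+ r \<in> {0<..<sqrt t}. ennreal (\<omega> * r ^ (CARD('n) - 1)) * ?h r \<partial>lborel)
        = ennreal (k * t powr (- N / 2)) * ennreal \<omega> * H (sqrt t)" by (simp only: mult.assoc)
    also have "ennreal (k * t powr (- N / 2)) * ennreal \<omega> = ennreal (k * t powr (- N / 2) * \<omega>)"
      using k by (intro ennreal_mult'[symmetric]) auto
    also have "k * t powr (- N / 2) * \<omega> = k * \<omega> * t powr (- (N / 2))" by simp
    finally show "ennreal (k * \<omega> * t powr (- (N / 2))) * H (sqrt t) \<le> ennreal (k * t powr (- N / 2)) *
      (\<integral>\<^sup>+ r \<in> {0<..<sqrt t}. ennreal (\<omega> * r ^ (CARD('n) - 1)) * ?h r \<partial>lborel)" by simp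
  qed simp
  show False
    by (rule blow_up_from_divergent_dini[OF D(2) q0 eq_e[unfolded N_def] _ t0(1,2) t01 H dini u[unfolded N_def] duh(2,3)])
      (use k \<omega> in auto)
qed

section \<open>Nonexistence of local-in-time solutions\<close>

theorem corollary1p2:
  fixes D1 D2 p q :: real
  assumes "D1 > 0" and "D2 > 0" and "0 < p" and "p \<le> q" and "p * q > 1"
  defines "N \<equiv> real CARD('n::finite)"
  shows
  "((q + 1) / (p * q - 1) < N / 2 \<longrightarrow>
     (\<exists>K>0. \<forall>(\<mu> :: real ^ 'n \<Rightarrow> ennreal) (\<nu> :: real ^ 'n \<Rightarrow> ennreal) c1 c2.
        nonneg_measurable \<mu> \<and> nonneg_measurable \<nu> \<and> c1 > 0 \<and> c2 > 0 \<and>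
        ge_near_0 \<mu> (\<lambda>x. c1 * norm x powr (- (2 * (p + 1) / (p * q - 1)))) \<and>
        ge_near_0 \<nu> (\<lambda>x. c2 * norm x powr (- (2 * (q + 1) / (p * q - 1)))) \<and>
        (c1 \<ge> K \<or> c2 \<ge> K) \<longrightarrow>
        no_local_solutions D1 D2 p q (Function_Datum \<mu>) (Function_Datum \<nu>)))
   \<and>
   ((q + 1) / (p * q - 1) = N / 2 \<and> p < q \<longrightarrow>
     (\<exists>K>0. \<forall>(\<mu> :: real ^ 'n \<Rightarrow> ennreal) (\<nu> :: real ^ 'n \<Rightarrow> ennreal) c1 c2.
        nonneg_measurable \<mu> \<and> nonneg_measurable \<nu> \<and> c1 > 0 \<and> c2 > 0 \<and>
        ge_near_0 \<mu> (\<lambda>x. c1 * norm x powr (- (2 * (p + 1) / (p * q - 1)))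
                              * \<bar>ln (norm x)\<bar> powr (- (p / (p * q - 1)))) \<and>
        ge_near_0 \<nu> (\<lambda>x. c2 * norm x powr (- N)
                              * \<bar>ln (norm x)\<bar> powr (- (1 / (p * q - 1)) - 1)) \<and>
        (c1 \<ge> K \<or> c2 \<ge> K) \<longrightarrow>
        no_local_solutions D1 D2 p q (Function_Datum \<mu>) (Function_Datum \<nu>)))
   \<and>
   ((q + 1) / (p * q - 1) = N / 2 \<and> p = q \<longrightarrow>
     (\<exists>K>0. \<forall>(\<mu> :: real ^ 'n \<Rightarrow> ennreal) (\<nu> :: real ^ 'n \<Rightarrow> ennreal) c1 c2.
        nonneg_measurable \<mu> \<and> nonneg_measurable \<nu> \<and> c1 > 0 \<and> c2 > 0 \<and>
        ge_near_0 \<mu> (\<lambda>x. c1 * norm x powr (- N) * \<bar>ln (norm x)\<bar> powr (- (N / 2) - 1)) \<and>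
        ge_near_0 \<nu> (\<lambda>x. c2 * norm x powr (- N) * \<bar>ln (norm x)\<bar> powr (- (N / 2) - 1)) \<and>
        (c1 \<ge> K \<or> c2 \<ge> K) \<longrightarrow>
        no_local_solutions D1 D2 p q (Function_Datum \<mu>) (Function_Datum \<nu>)))
   \<and>
   ((q + 1) / (p * q - 1) > N / 2 \<and> q > 1 + 2 / N \<longrightarrow>
     (\<forall>(\<mu> :: real ^ 'n \<Rightarrow> ennreal) (\<nu> :: (real ^ 'n) measure) h1.
        nonneg_measurable \<mu> \<and> radon_measure \<nu> \<and> pos_cont h1 \<and>
        (\<exists>\<epsilon>>0. \<exists>\<delta>>0. antimono_on {0<..<\<delta>} (\<lambda>s. s powr (- \<epsilon>) * h1 s)) \<and>
        ge_near_0 \<mu> (\<lambda>x. norm x powr (- ((N + 2) / q)) * h1 (norm x)) \<and>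
        ((\<integral>\<^sup>+ \<tau> \<in> {0<..<1}. ennreal (\<tau> powr (- 1) * h1 \<tau> powr q) \<partial>lborel) = \<infinity> \<or>
         (SUP x. emeasure \<nu> (ball x 1)) = \<infinity>) \<longrightarrow>
        no_local_solutions D1 D2 p q (Function_Datum \<mu>) (Measure_Datum \<nu>)))
   \<and>
   ((q + 1) / (p * q - 1) > N / 2 \<and> q = 1 + 2 / N \<longrightarrow>
     (\<forall>(\<mu> :: real ^ 'n \<Rightarrow> ennreal) (\<nu> :: (real ^ 'n) measure) h2.
        nonneg_measurable \<mu> \<and> radon_measure \<nu> \<and> pos_cont h2 \<and>
        ge_near_0 \<mu> (\<lambda>x. norm x powr (- N) * h2 (norm x)) \<and>
        ((\<integral>\<^sup>+ r \<in> {0<..<1}.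
             ennpow (\<integral>\<^sup>+ \<tau> \<in> {0<..<r}. ennreal (\<tau> powr (- 1) * h2 \<tau>) \<partial>lborel) q
               * ennreal (r powr (- 1)) \<partial>lborel) = \<infinity> \<or>
         (SUP x. emeasure \<nu> (ball x 1)) = \<infinity>) \<longrightarrow>
        no_local_solutions D1 D2 p q (Function_Datum \<mu>) (Measure_Datum \<nu>)))
   \<and>
   ((q + 1) / (p * q - 1) > N / 2 \<and> q < 1 + 2 / N \<longrightarrow>
     (\<forall>(\<mu> :: (real ^ 'n) measure) (\<nu> :: (real ^ 'n) measure).
        radon_measure \<mu> \<and> radon_measure \<nu> \<and>
        ((SUP x. emeasure \<mu> (ball x 1)) = \<infinity> \<or> (SUP x. emeasure \<nu> (ball x 1)) = \<infinity>) \<longrightarrow>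
        no_local_solutions D1 D2 p q (Measure_Datum \<mu>) (Measure_Datum \<nu>)))"
proof -
  have q: "0 < q" using \<open>0 < p\<close> \<open>p \<le> q\<close> by linarith
  have qp: "1 < q * p" using \<open>p * q > 1\<close> by (simp add: mult.commute)
  note D = \<open>D1 > 0\<close> \<open>D2 > 0\<close>
  have N: "0 < N" by (simp add: N_def)
  define \<Delta> where "\<Delta> = p * q - 1"
  have \<Delta>: "0 < \<Delta>" using \<open>p * q > 1\<close> by (simp add: \<Delta>_def)
  define \<alpha> where "\<alpha> = (p + 1) / \<Delta>"
  define \<beta> where "\<beta> = (q + 1) / \<Delta>"
  have \<alpha>\<beta>: "0 < \<alpha>" "0 < \<beta>" using \<open>0 < p\<close> q \<Delta> by (simp_all add: \<alpha>_def \<beta>_def)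
  (* the exponents of the self-similar solution of the system of ordinary differential equations *)
  have scaling: "\<beta> = \<alpha> * q - 1" "\<alpha> = \<beta> * p - 1"
    using \<Delta> by (simp_all add: \<alpha>_def \<beta>_def \<Delta>_def field_simps)
  have no_log: "ge_near_0 f (\<lambda>x. c * norm x powr (- (2 * a)) * \<bar>ln (norm x)\<bar> powr (- 0))"
    if "ge_near_0 f (\<lambda>x. c * norm x powr (- (2 * a)))" for f :: "real ^ 'n \<Rightarrow> ennreal" and c a
  proof -
    have "\<forall>\<^sub>F x :: real ^ 'n in at 0. x \<noteq> 0 \<and> norm x < 1"
      unfolding eventually_at by (intro exI[of _ 1]) auto
    with that[unfolded ge_near_0_def] show ?thesis
      unfolding ge_near_0_def by eventually_elim simp
  qed
  have uniform: False
    if "radon_measure M" "(SUP x. emeasure M (ball x 1)) = \<infinity>" "0 < T"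
      "is_solution D1 D2 p q (Measure_Datum M) \<nu> T u v \<or> is_solution D1 D2 p q \<nu> (Measure_Datum M) T u v"
    for M :: "(real ^ 'n) measure" and \<nu> T u v
    using that(4)
  proof
    assume "is_solution D1 D2 p q (Measure_Datum M) \<nu> T u v"
    note sol = is_solutionD[OF this]
    show False
      by (rule no_solution_if_not_uniformly_local[OF D \<open>0 < p\<close> q \<open>p * q > 1\<close> that(3,1,2) sol(1,2,3)])
  next
    assume "is_solution D1 D2 p q \<nu> (Measure_Datum M) T u v"
    note sol = is_solutionD[OF this]
    show False
      by (rule no_solution_if_not_uniformly_local[OF D(2,1) q \<open>0 < p\<close> qp that(3,1,2) sol(2,1,4)])
  qed
  show ?thesis
  proof (intro conjI impI, goal_cases)
    case 1
    have "weight_transfer N q \<alpha> 0 \<beta> 0" "weight_transfer N p \<beta> 0 \<alpha> 0"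
      using scaling by (auto simp: weight_transfer_def)
    note tr = this[unfolded N_def]
    obtain K where "K > 0" and K: "\<And>(\<mu> :: real ^ 'n \<Rightarrow> ennreal) (\<nu> :: real ^ 'n \<Rightarrow> ennreal) c1 c2.
      0 < c1 \<and> 0 < c2 \<and>
      ge_near_0 \<mu> (\<lambda>x. c1 * norm x powr (- (2 * \<alpha>)) * \<bar>ln (norm x)\<bar> powr (- 0)) \<and>
      ge_near_0 \<nu> (\<lambda>x. c2 * norm x powr (- (2 * \<beta>)) * \<bar>ln (norm x)\<bar> powr (- 0)) \<and>
      (K \<le> c1 \<or> K \<le> c2) \<Longrightarrow> no_local_solutions D1 D2 p q (Function_Datum \<mu>) (Function_Datum \<nu>)"
      using critical_profile_nonexistence[where 'n = 'n, OF D \<open>0 < p\<close> q \<open>p * q > 1\<close> less_imp_le[OF \<alpha>\<beta>(1)] order_refl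
          less_imp_le[OF \<alpha>\<beta>(2)] order_refl tr disjI1[OF refl] disjI1[OF refl]] by blast
    have "2 * (p + 1) / (p * q - 1) = 2 * \<alpha>" "2 * (q + 1) / (p * q - 1) = 2 * \<beta>"
      by (simp_all add: \<alpha>_def \<beta>_def \<Delta>_def)
    note exps = this
    show ?case
      unfolding exps
    proof (intro exI[of _ K] conjI allI impI \<open>K > 0\<close>, elim conjE)
      fix \<mu> \<nu> :: "real ^ 'n \<Rightarrow> ennreal" and c1 c2
      assume "0 < c1" "0 < c2" "ge_near_0 \<mu> (\<lambda>x. c1 * norm x powr (- (2 * \<alpha>)))"
        "ge_near_0 \<nu> (\<lambda>x. c2 * norm x powr (- (2 * \<beta>)))" "K \<le> c1 \<or> K \<le> c2"
      then show "no_local_solutions D1 D2 p q (Function_Datum \<mu>) (Function_Datum \<nu>)"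
        by (intro K conjI no_log)
    qed
  next
    case 2
    then have crit: "\<beta> = N / 2" by (simp add: \<beta>_def \<Delta>_def)
    define a where "a = p / \<Delta>"
    define b where "b = 1 / \<Delta>"
    have ab: "0 \<le> a" "0 \<le> b" using \<open>0 < p\<close> \<Delta> by (simp_all add: a_def b_def)
    (* the equation for v gains a power of the logarithm, the one for u does not *)
    have "b = a * q - 1" using \<Delta> by (simp add: a_def b_def \<Delta>_def field_simps)
    moreover have "a = b * p" by (simp add: a_def b_def)
    ultimately have tr: "weight_transfer N q \<alpha> a \<beta> b" "weight_transfer N p \<beta> b \<alpha> a"
      using scaling crit by (auto simp: weight_transfer_def)
    have exps: "b + 1 = b \<or> (\<beta> = N / 2 \<and> b + 1 = b + 1)"
      using crit by auto
    obtain K where "K > 0" and K: "\<And>(\<mu> :: real ^ 'n \<Rightarrow> ennreal) (\<nu> :: real ^ 'n \<Rightarrow> ennreal) c1 c2.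
      0 < c1 \<and> 0 < c2 \<and>
      ge_near_0 \<mu> (\<lambda>x. c1 * norm x powr (- (2 * \<alpha>)) * \<bar>ln (norm x)\<bar> powr (- a)) \<and>
      ge_near_0 \<nu> (\<lambda>x. c2 * norm x powr (- (2 * \<beta>)) * \<bar>ln (norm x)\<bar> powr (- (b + 1))) \<and>
      (K \<le> c1 \<or> K \<le> c2) \<Longrightarrow> no_local_solutions D1 D2 p q (Function_Datum \<mu>) (Function_Datum \<nu>)"
      using critical_profile_nonexistence[where 'n = 'n, OF D \<open>0 < p\<close> q \<open>p * q > 1\<close> less_imp_le[OF \<alpha>\<beta>(1)] ab(1)
          less_imp_le[OF \<alpha>\<beta>(2)] ab(2) tr[unfolded N_def] disjI1[OF refl] exps[unfolded N_def]] by blast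
    have "2 * (p + 1) / (p * q - 1) = 2 * \<alpha>" "N = 2 * \<beta>" "p / (p * q - 1) = a" "- (1 / (p * q - 1)) - 1 = - (b + 1)"
      using crit by (simp_all add: \<alpha>_def \<Delta>_def a_def b_def)
    note exps = this
    show ?case
      unfolding exps
    proof (intro exI[of _ K] conjI allI impI \<open>K > 0\<close>, elim conjE)
      fix \<mu> \<nu> :: "real ^ 'n \<Rightarrow> ennreal" and c1 c2
      assume "0 < c1" "0 < c2" "ge_near_0 \<mu> (\<lambda>x. c1 * norm x powr (- (2 * \<alpha>)) * \<bar>ln (norm x)\<bar> powr (- a))"
        "ge_near_0 \<nu> (\<lambda>x. c2 * norm x powr (- (2 * \<beta>)) * \<bar>ln (norm x)\<bar> powr (- (b + 1)))" "K \<le> c1 \<or> K \<le> c2"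
      then show "no_local_solutions D1 D2 p q (Function_Datum \<mu>) (Function_Datum \<nu>)"
        by (intro K conjI)
    qed
  next
    case 3
    then have crit: "\<beta> = N / 2" and "p = q" unfolding \<beta>_def \<Delta>_def by blast+
    have eq: "\<alpha> = \<beta>" using \<open>p = q\<close> by (simp add: \<alpha>_def \<beta>_def)
    have N_eq: "N / 2 * q = N / 2 + 1" using scaling(1)[unfolded eq crit] by linarith
    have "weight_transfer N q \<beta> (N / 2) \<beta> (N / 2)"
      unfolding weight_transfer_def crit using N_eq by (intro disjI2 conjI refl) linarith+
    then have tr: "weight_transfer N q \<beta> (N / 2) \<beta> (N / 2)" "weight_transfer N p \<beta> (N / 2) \<beta> (N / 2)"
      using \<open>p = q\<close> by simp_all
    have exps: "N / 2 + 1 = N / 2 \<or> (\<beta> = N / 2 \<and> N / 2 + 1 = N / 2 + 1)" using crit by simp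
    have N2: "0 \<le> N / 2" using N by simp
    obtain K where "K > 0" and K: "\<And>(\<mu> :: real ^ 'n \<Rightarrow> ennreal) (\<nu> :: real ^ 'n \<Rightarrow> ennreal) c1 c2.
      0 < c1 \<and> 0 < c2 \<and>
      ge_near_0 \<mu> (\<lambda>x. c1 * norm x powr (- (2 * \<beta>)) * \<bar>ln (norm x)\<bar> powr (- (N / 2 + 1))) \<and>
      ge_near_0 \<nu> (\<lambda>x. c2 * norm x powr (- (2 * \<beta>)) * \<bar>ln (norm x)\<bar> powr (- (N / 2 + 1))) \<and>
      (K \<le> c1 \<or> K \<le> c2) \<Longrightarrow> no_local_solutions D1 D2 p q (Function_Datum \<mu>) (Function_Datum \<nu>)"
      using critical_profile_nonexistence[where 'n = 'n, OF D \<open>0 < p\<close> q \<open>p * q > 1\<close> less_imp_le[OF \<alpha>\<beta>(2)] N2[unfolded N_def]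
          less_imp_le[OF \<alpha>\<beta>(2)] N2[unfolded N_def] tr[unfolded N_def] exps[unfolded N_def] exps[unfolded N_def]]
      unfolding N_def[symmetric] by blast
    have "N = 2 * \<beta>" "- (N / 2) - 1 = - (N / 2 + 1)" using crit by simp_all
    then have exps: "norm x powr (- N) = norm x powr (- (2 * \<beta>))"
        "\<bar>ln (norm x)\<bar> powr (- (N / 2) - 1) = \<bar>ln (norm x)\<bar> powr (- (N / 2 + 1))" for x :: "real ^ 'n"
      by (simp_all only:)
    show ?case
      unfolding exps
    proof (intro exI[of _ K] conjI allI impI \<open>K > 0\<close>, elim conjE)
      fix \<mu> \<nu> :: "real ^ 'n \<Rightarrow> ennreal" and c1 c2
      assume "0 < c1" "0 < c2" "ge_near_0 \<mu> (\<lambda>x. c1 * norm x powr (- (2 * \<beta>)) * \<bar>ln (norm x)\<bar> powr (- (N / 2 + 1)))"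
        "ge_near_0 \<nu> (\<lambda>x. c2 * norm x powr (- (2 * \<beta>)) * \<bar>ln (norm x)\<bar> powr (- (N / 2 + 1)))" "K \<le> c1 \<or> K \<le> c2"
      then show "no_local_solutions D1 D2 p q (Function_Datum \<mu>) (Function_Datum \<nu>)"
        by (intro K conjI)
    qed
  next
    case 4
    show ?case
    proof (intro allI impI)
      fix \<mu> :: "real ^ 'n \<Rightarrow> ennreal" and \<nu> :: "(real ^ 'n) measure" and h
      assume *: "nonneg_measurable \<mu> \<and> radon_measure \<nu> \<and> pos_cont h \<and>
        (\<exists>\<epsilon>>0. \<exists>\<delta>>0. antimono_on {0<..<\<delta>} (\<lambda>s. s powr (- \<epsilon>) * h s)) \<and>
        ge_near_0 \<mu> (\<lambda>x. norm x powr (- ((N + 2) / q)) * h (norm x)) \<and>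
        ((\<integral>\<^sup>+ \<tau> \<in> {0<..<1}. ennreal (\<tau> powr (- 1) * h \<tau> powr q) \<partial>lborel) = \<infinity> \<or>
         (SUP x. emeasure \<nu> (ball x 1)) = \<infinity>)"
      then obtain \<epsilon> \<delta> where eps: "0 < \<epsilon>" "0 < \<delta>" "antimono_on {0<..<\<delta>} (\<lambda>s. s powr (- \<epsilon>) * h s)"
        by blast
      show "no_local_solutions D1 D2 p q (Function_Datum \<mu>) (Measure_Datum \<nu>)"
        unfolding no_local_solutions_def
      proof (intro notI, elim exE conjE)
        fix T u v
        assume T: "0 < T" and sol: "is_solution D1 D2 p q (Function_Datum \<mu>) (Measure_Datum \<nu>) T u v"
        note duh = is_solutionD[OF sol]
        from * have "(\<integral>\<^sup>+ \<tau> \<in> {0<..<1}. ennreal (\<tau> powr (- 1) * h \<tau> powr q) \<partial>lborel) = \<infinity> \<or>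
         (SUP x. emeasure \<nu> (ball x 1)) = \<infinity>" by blast
        then show False
        proof
          assume "(SUP x. emeasure \<nu> (ball x 1)) = \<infinity>"
          then show False using uniform[OF _ _ T] * sol by blast
        next
          assume "(\<integral>\<^sup>+ \<tau> \<in> {0<..<1}. ennreal (\<tau> powr (- 1) * h \<tau> powr q) \<partial>lborel) = \<infinity>"
          then show False
            using divergent_supercritical_profile_nonexistence[OF D q T _ eps _ _ duh(1,2,4)] *
            unfolding N_def by blast
        qed
      qed
    qed
  next
    case 5
    then have q_eq: "q = 1 + 2 / N" by simp
    show ?case
    proof (intro allI impI)
      fix \<mu> :: "real ^ 'n \<Rightarrow> ennreal" and \<nu> :: "(real ^ 'n) measure" and h
      assume *: "nonneg_measurable \<mu> \<and> radon_measure \<nu> \<and> pos_cont h \<and>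
        ge_near_0 \<mu> (\<lambda>x. norm x powr (- N) * h (norm x)) \<and>
        ((\<integral>\<^sup>+ r \<in> {0<..<1}.
             ennpow (\<integral>\<^sup>+ \<tau> \<in> {0<..<r}. ennreal (\<tau> powr (- 1) * h \<tau>) \<partial>lborel) q
               * ennreal (r powr (- 1)) \<partial>lborel) = \<infinity> \<or>
         (SUP x. emeasure \<nu> (ball x 1)) = \<infinity>)"
      show "no_local_solutions D1 D2 p q (Function_Datum \<mu>) (Measure_Datum \<nu>)"
        unfolding no_local_solutions_def
      proof (intro notI, elim exE conjE)
        fix T u v
        assume T: "0 < T" and sol: "is_solution D1 D2 p q (Function_Datum \<mu>) (Measure_Datum \<nu>) T u v"
        note duh = is_solutionD[OF sol]
        show False
        proof (cases "(SUP x. emeasure \<nu> (ball x 1)) = \<infinity>")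
          case True
          then show False using uniform[OF _ _ T] * sol by blast
        next
          case False
          with * show False
            using divergent_critical_profile_nonexistence[OF D q_eq[unfolded N_def] T _ _ _ duh(1,2,4)]
            unfolding N_def by blast
        qed
      qed
    qed
  next
    case 6
    show ?case
      unfolding no_local_solutions_def using uniform by blast
  qed
qed

end
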